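(* Let $\mathcal{P}=\mathrm{PSL}(2,\mathbb{Z}[i])$ and let $g\in\mathcal{P}$. Then $g$ is reversible in $\mathcal{P}$ if and only if one of the following holds: (1) $g$ is elliptic; (2) $g$ is parabolic; (3) $g$ is loxodromic and is conjugate in $\mathcal{P}$ to an element $h$ such that $f_h\in\{0,\,1,\,i,\,1+i\}$. Furthermore, every conjugacy class in $\mathcal{P}$ of reversible loxodromic elements whose centralizer in $\mathcal{P}$ is infinite cyclic contains exactly eight elements $h$ with $f_h\in\{0,1,i,1+i\}$.
   Context: $\mathbb{Z}[i]$ is the ring of Gaussian integers and $\mathcal{P}=\mathrm{PSL}(2,\mathbb{Z}[i])=\mathrm{SL}(2,\mathbb{Z}[i])/\{\pm \mathrm{Id}\}$ (the Picard modular group), acting on hyperbolic space $\mathbb{H}^3$ and, by Möbius transformations, on $\partial\mathbb{H}^3=\mathbb{C}\cup\{\infty\}$. An element of $\mathrm{PSL}(2,\mathbb{C})$ is elliptic if it fixes a point of $\mathbb{H}^3$, parabolic if it has exactly one fixed point on $\partial\mathbb{H}^3$, and loxodromic if it is not elliptic and has exactly two fixed points on $\partial\mathbb{H}^3$. An element $g$ of a group $G$ is reversible if there is $h\in G$ with $hgh^{-1}=g^{-1}$. For a loxodromic $A\in\mathcal{P}$ with lift $\begin{pmatrix} a&b\\ c&d\end{pmatrix}\in\mathrm{SL}(2,\mathbb{Z}[i])$ (for which $c\neq0$), put $f_A:=\dfrac{a-d}{c}$; this does not depend on the choice of lift. *)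

theory Defs
  imports "HOL-Analysis.Determinants" "HOL-Algebra.Elementary_Groups" "HOL-Algebra.Group_Action"
begin

section \<open>Conjugacy, reversibility and centralizers\<close>

definition conjugacy_class :: "('a, 'b) monoid_scheme \<Rightarrow> 'a \<Rightarrow> 'a set" where
  "conjugacy_class G g = {h \<otimes>\<^bsub>G\<^esub> g \<otimes>\<^bsub>G\<^esub> inv\<^bsub>G\<^esub> h | h. h \<in> carrier G}"

definition reversible :: "('a, 'b) monoid_scheme \<Rightarrow> 'a \<Rightarrow> bool" where
  "reversible G g \<longleftrightarrow> (\<exists>h \<in> carrier G. h \<otimes>\<^bsub>G\<^esub> g \<otimes>\<^bsub>G\<^esub> inv\<^bsub>G\<^esub> h = inv\<^bsub>G\<^esub> g)"

definition centralizer :: "('a, 'b) monoid_scheme \<Rightarrow> 'a \<Rightarrow> 'a set" where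
  "centralizer G g = {h \<in> carrier G. h \<otimes>\<^bsub>G\<^esub> g = g \<otimes>\<^bsub>G\<^esub> h}"

definition infinite_cyclic :: "('a, 'b) monoid_scheme \<Rightarrow> 'a set \<Rightarrow> bool" where
  "infinite_cyclic G H \<longleftrightarrow> infinite H \<and> cyclic_group (G\<lparr>carrier := H\<rparr>)"


section \<open>The groups SL(2,R) and PSL(2,R) for a subring R of the complex numbers\<close>

definition SL2 :: "complex set \<Rightarrow> (complex^2^2) monoid" where
  "SL2 R = \<lparr>carrier = {A. (\<forall>i j. A $ i $ j \<in> R) \<and> det A = 1}, mult = (**), one = mat 1\<rparr>"

text \<open>An element of \<open>PSL2 R\<close> is the coset \<open>{A, - A}\<close> consisting of its two lifts to \<open>SL2 R\<close>.
  In particular elements of \<open>PSL2 R\<close> are also elements of \<open>PSL2 UNIV\<close>.\<close>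

definition PSL2 :: "complex set \<Rightarrow> (complex^2^2) set monoid" where
  "PSL2 R = SL2 R Mod {mat 1, - mat 1}"

definition gauss_ints :: "complex set" where
  "gauss_ints = {z. Re z \<in> \<int> \<and> Im z \<in> \<int>}"

definition Picard :: "(complex^2^2) set monoid" where
  "Picard = PSL2 gauss_ints"


section \<open>The actions on the Riemann sphere and on hyperbolic space\<close>

text \<open>The value \<open>None\<close> represents the point at infinity.\<close>

definition moebius :: "complex^2^2 \<Rightarrow> complex option \<Rightarrow> complex option" where
  "moebius A p =
     (let a = A $ 1 $ 1; b = A $ 1 $ 2; c = A $ 2 $ 1; d = A $ 2 $ 2 in
      case p of
        None \<Rightarrow> if c = 0 then None else Some (a / c)
      | Some z \<Rightarrow> if c * z + d = 0 then None else Some ((a * z + b) / (c * z + d)))"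

text \<open>Upper half-space model of hyperbolic 3-space.\<close>

definition H3 :: "(complex \<times> real) set" where
  "H3 = {(z, t). t > 0}"

text \<open>The Poincare extension of a Moebius transformation of determinant one: the point
  \<open>(z, t)\<close> is the quaternion \<open>q = z + t j\<close>, and the formula is \<open>(a q + b) (c q + d)\<^sup>-\<^sup>1\<close>
  written out in coordinates.\<close>

definition poincare_ext :: "complex^2^2 \<Rightarrow> complex \<times> real \<Rightarrow> complex \<times> real" where
  "poincare_ext A = (\<lambda>(z, t).
     (let a = A $ 1 $ 1; b = A $ 1 $ 2; c = A $ 2 $ 1; d = A $ 2 $ 2;
          n = (cmod (c * z + d))\<^sup>2 + (cmod c)\<^sup>2 * t\<^sup>2 in
      (((a * z + b) * cnj (c * z + d) + a * cnj c * of_real (t\<^sup>2)) / of_real n, t / n)))"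

text \<open>Functions of a matrix that agree on \<open>A\<close> and \<open>- A\<close> are transferred to the coset \<open>{A, - A}\<close>
  by \<^const>\<open>the_elem\<close>; see the lemma \<open>PSL2_lift\<close> below.\<close>

definition act_sphere :: "(complex^2^2) set \<Rightarrow> complex option \<Rightarrow> complex option" where
  "act_sphere g p = the_elem ((\<lambda>A. moebius A p) ` g)"

definition act_H3 :: "(complex^2^2) set \<Rightarrow> complex \<times> real \<Rightarrow> complex \<times> real" where
  "act_H3 g x = the_elem ((\<lambda>A. poincare_ext A x) ` g)"

definition elliptic :: "(complex^2^2) set \<Rightarrow> bool" where
  "elliptic g \<longleftrightarrow> invariants H3 act_H3 g \<noteq> {}"

definition parabolic :: "(complex^2^2) set \<Rightarrow> bool" where
  "parabolic g \<longleftrightarrow> card (invariants UNIV act_sphere g) = 1"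

definition loxodromic :: "(complex^2^2) set \<Rightarrow> bool" where
  "loxodromic g \<longleftrightarrow> \<not> elliptic g \<and> card (invariants UNIV act_sphere g) = 2"

text \<open>The quantity \<open>f\<^sub>g\<close>. It is meaningful only if the lower left entry of a lift is nonzero,
  which holds for every loxodromic element of the Picard group.\<close>

definition f_of :: "(complex^2^2) set \<Rightarrow> complex" where
  "f_of g = the_elem ((\<lambda>A. (A $ 1 $ 1 - A $ 2 $ 2) / A $ 2 $ 1) ` g)"


section \<open>Well-definedness\<close>

lemma gauss_ints_closed:
  "0 \<in> gauss_ints" "1 \<in> gauss_ints"
  "x \<in> gauss_ints \<Longrightarrow> - x \<in> gauss_ints"
  "x \<in> gauss_ints \<Longrightarrow> y \<in> gauss_ints \<Longrightarrow> x + y \<in> gauss_ints"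
  "x \<in> gauss_ints \<Longrightarrow> y \<in> gauss_ints \<Longrightarrow> x * y \<in> gauss_ints"
  by (auto simp: gauss_ints_def)

lemma mat2_eq_iff:
  "(A :: complex^2^2) = B \<longleftrightarrow>
     A $ 1 $ 1 = B $ 1 $ 1 \<and> A $ 1 $ 2 = B $ 1 $ 2 \<and> A $ 2 $ 1 = B $ 2 $ 1 \<and> A $ 2 $ 2 = B $ 2 $ 2"
  by (auto simp: vec_eq_iff forall_2)

lemma carrier_SL2_iff:
  "A \<in> carrier (SL2 R) \<longleftrightarrow> A $ 1 $ 1 \<in> R \<and> A $ 1 $ 2 \<in> R \<and> A $ 2 $ 1 \<in> R \<and> A $ 2 $ 2 \<in> R
     \<and> A $ 1 $ 1 * A $ 2 $ 2 - A $ 1 $ 2 * A $ 2 $ 1 = 1"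
  by (auto simp: SL2_def forall_2 det_2)

lemma SL2_simps [simp]:
  "A \<otimes>\<^bsub>SL2 R\<^esub> B = A ** B" "\<one>\<^bsub>SL2 R\<^esub> = mat 1"
  by (simp_all add: SL2_def)

lemma mat2_mult:
  fixes A B :: "complex^2^2"
  shows "(A ** B) $ i $ j = A $ i $ 1 * B $ 1 $ j + A $ i $ 2 * B $ 2 $ j"
  by (simp add: matrix_matrix_mult_def sum_2)

lemma mat2_one:
  "(mat 1 :: complex^2^2) $ 1 $ 1 = 1" "(mat 1 :: complex^2^2) $ 1 $ 2 = 0"
  "(mat 1 :: complex^2^2) $ 2 $ 1 = 0" "(mat 1 :: complex^2^2) $ 2 $ 2 = 1"
  by (simp_all add: mat_def)

locale subring_C =
  fixes R :: "complex set"
  assumes R_zero: "0 \<in> R" and R_one: "1 \<in> R"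
    and R_uminus: "x \<in> R \<Longrightarrow> - x \<in> R"
    and R_add: "x \<in> R \<Longrightarrow> y \<in> R \<Longrightarrow> x + y \<in> R"
    and R_mult: "x \<in> R \<Longrightarrow> y \<in> R \<Longrightarrow> x * y \<in> R"
begin

lemma group_SL2: "group (SL2 R)"
proof (rule groupI)
  fix A assume A: "A \<in> carrier (SL2 R)"
  define B :: "complex^2^2" where
    "B = vector [vector [A $ 2 $ 2, - A $ 1 $ 2], vector [- A $ 2 $ 1, A $ 1 $ 1]]"
  have "B \<in> carrier (SL2 R)" "B ** A = mat 1"
    using A
    by (auto simp: carrier_SL2_iff B_def mat2_eq_iff mat2_mult mat2_one R_uminus algebra_simps)
  then show "\<exists>B\<in>carrier (SL2 R). B \<otimes>\<^bsub>SL2 R\<^esub> A = \<one>\<^bsub>SL2 R\<^esub>"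
    by auto
next
  fix A B assume "A \<in> carrier (SL2 R)" "B \<in> carrier (SL2 R)"
  then show "A \<otimes>\<^bsub>SL2 R\<^esub> B \<in> carrier (SL2 R)"
    by (simp add: SL2_def det_mul mat2_mult R_add R_mult)
qed (auto simp: carrier_SL2_iff mat2_one R_zero R_one matrix_mul_assoc)

lemma normal_pm_one: "{mat 1, - mat 1} \<lhd> SL2 R"
proof -
  interpret group "SL2 R" by (rule group_SL2)
  have [simp]: "mat 1 \<in> carrier (SL2 R)" "- mat 1 \<in> carrier (SL2 R)"
    by (simp_all add: carrier_SL2_iff mat2_one R_zero R_one R_uminus)
  have [simp]: "- mat 1 ** - mat 1 = (mat 1 :: complex^2^2)"
    by (simp add: mat2_eq_iff mat2_mult mat2_one)
  have [simp]: "inv\<^bsub>SL2 R\<^esub> (- mat 1) = - mat 1"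
    by (rule inv_equality) auto
  have [simp]: "inv\<^bsub>SL2 R\<^esub> (mat 1) = mat 1"
    by (rule inv_equality) auto
  have "subgroup {mat 1, - mat 1} (SL2 R)"
    by (rule subgroupI) auto
  moreover have "A ** - mat 1 = - mat 1 ** A" for A :: "complex^2^2"
    by (simp add: mat2_eq_iff mat2_mult mat2_one)
  ultimately show ?thesis
    by (intro normalI) (auto simp: r_coset_def l_coset_def)
qed

lemma group_PSL2: "group (PSL2 R)"
  unfolding PSL2_def by (rule normal.factorgroup_is_group[OF normal_pm_one])

end

interpretation gauss: subring_C gauss_ints
  by unfold_locales (auto simp: gauss_ints_closed)

interpretation complex: subring_C UNIV
  by unfold_locales auto

lemma group_Picard: "group Picard"
  unfolding Picard_def by (rule gauss.group_PSL2)

lemma carrier_PSL2: "carrier (PSL2 R) = (\<lambda>A. {A, - A}) ` carrier (SL2 R)"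
proof -
  have "- mat 1 ** A = - A" for A :: "complex^2^2"
    by (simp add: mat2_eq_iff mat2_mult mat2_one)
  then show ?thesis
    by (auto simp: PSL2_def carrier_FactGroup r_coset_def image_iff)
qed

lemma moebius_uminus: "moebius (- A) p = moebius A p"
proof (cases p)
  case (Some z)
  have "- A $ 2 $ 1 * z + - A $ 2 $ 2 = - (A $ 2 $ 1 * z + A $ 2 $ 2)"
    "- A $ 1 $ 1 * z + - A $ 1 $ 2 = - (A $ 1 $ 1 * z + A $ 1 $ 2)"
    by simp_all
  then show ?thesis
    unfolding moebius_def Let_def Some option.case vector_uminus_component
    by (metis minus_divide_divide neg_equal_0_iff_equal)
qed (simp add: moebius_def)

lemma poincare_ext_uminus: "poincare_ext (- A) x = poincare_ext A x"
proof -
  have "- (A $ 2 $ 1 * z) - A $ 2 $ 2 = - (A $ 2 $ 1 * z + A $ 2 $ 2)" for z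
    by simp
  then have "cmod (- (A $ 2 $ 1 * z) - A $ 2 $ 2) = cmod (A $ 2 $ 1 * z + A $ 2 $ 2)" for z
    by (metis norm_minus_cancel)
  then show ?thesis
    by (cases x) (simp add: poincare_ext_def Let_def algebra_simps)
qed

lemma PSL2_lift:
  "act_sphere {A, - A} p = moebius A p"
  "act_H3 {A, - A} x = poincare_ext A x"
  "f_of {A, - A} = (A $ 1 $ 1 - A $ 2 $ 2) / A $ 2 $ 1"
proof -
  have "- A $ 1 $ 1 + A $ 2 $ 2 = - (A $ 1 $ 1 - A $ 2 $ 2)" by simp
  then have "(A $ 2 $ 2 - A $ 1 $ 1) / - A $ 2 $ 1 = (A $ 1 $ 1 - A $ 2 $ 2) / A $ 2 $ 1"
    by (metis minus_diff_eq minus_divide_divide)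
  then show "f_of {A, - A} = (A $ 1 $ 1 - A $ 2 $ 2) / A $ 2 $ 1"
    by (simp add: f_of_def)
qed (simp_all add: act_sphere_def act_H3_def moebius_uminus poincare_ext_uminus)

end

theory Submission
  imports Defs "HOL-Algebra.Multiplicative_Group"
begin

text \<open>Let \<open>A\<close> be a matrix of determinant 1 with rows \<open>(a, b)\<close> and \<open>(c, d)\<close>, with \<open>c \<noteq> 0\<close> and nonzero trace. An
  element \<open>H\<close> that reverses \<open>A\<close> satisfies \<open>H A = A\<^sup>-\<^sup>1 H\<close>, where \<open>A\<^sup>-\<^sup>1\<close> is the adjugate of \<open>A\<close>; comparing entries
  shows that \<open>H\<close> has trace 0 and satisfies one linear equation (\<open>reverser_trace_zero\<close>). So every
  reverser is an involution. Over the Euclidean ring \<open>\<int>[\<i>]\<close>, each matrix of trace 0 can be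
  triangularized, and it is therefore conjugate to one of the half-turns \<open>z \<mapsto> f - z\<close> with
  \<open>f \<in> {0, 1, \<i>, 1 + \<i>}\<close>, here called \<open>eta f\<close> (\<open>involution_conjugate_eta\<close>). For \<open>H = eta f\<close> the linear
  equation reads \<open>(a - d) / c = f\<close>. Thus a loxodromic element is reversible if and only if it has a
  conjugate \<open>h\<close> with \<open>f_of h\<close> in this set.

  The same equation gives the rest of the characterization. Whenever \<open>c\<close> divides \<open>a - d\<close> in \<open>\<int>[\<i>]\<close>, the
  quotient \<open>f\<close> provides a reverser \<open>eta f\<close> (\<open>eta_reverser\<close>). Parabolic elements are conjugate to
  translations. Elliptic elements other than the identity have trace 0, and then they are
  involutions, or trace \<open>\<plusminus> 1\<close>; a descent on \<open>|c|\<close> conjugates the latter to elements for which \<open>c\<close> is a unit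
  (\<open>reversible_trace_one\<close>).

  For the count, let \<open>Z\<close> be the infinite cyclic centralizer of \<open>g\<close>. The reversers of \<open>g\<close> form a coset of \<open>Z\<close>
  consisting of involutions, and they fall into two classes under conjugation by \<open>Z\<close>. Each class
  belongs to exactly one \<open>eta f\<close>, since the four half-turns are pairwise not conjugate, and contributes as
  many elements \<open>h\<close> as the centralizer of \<open>eta f\<close> has, namely four
  (\<open>card_conjugates_with_reverser\<close>, \<open>card_centralizer_eta\<close>). This gives \<open>2 \<cdot> 4 = 8\<close>.\<close>

section \<open>Elements inverted by a given element\<close>

definition conjugate :: "('a, 'b) monoid_scheme \<Rightarrow> 'a \<Rightarrow> 'a \<Rightarrow> 'a" where
  "conjugate G x y = x \<otimes>\<^bsub>G\<^esub> y \<otimes>\<^bsub>G\<^esub> inv\<^bsub>G\<^esub> x"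

definition reverser :: "('a, 'b) monoid_scheme \<Rightarrow> 'a \<Rightarrow> 'a \<Rightarrow> bool" where
  "reverser G g k \<longleftrightarrow> k \<in> carrier G \<and> conjugate G k g = inv\<^bsub>G\<^esub> g"

lemma reversible_iff_reverser: "reversible G g \<longleftrightarrow> (\<exists>k. reverser G g k)"
  by (auto simp: reversible_def reverser_def conjugate_def)

lemma conjugacy_class_eq_conjugate: "conjugacy_class G g = {conjugate G x g | x. x \<in> carrier G}"
  by (auto simp: conjugacy_class_def conjugate_def)

context group
begin

lemma conjugate_closed [simp]: "x \<in> carrier G \<Longrightarrow> y \<in> carrier G \<Longrightarrow> conjugate G x y \<in> carrier G"
  by (simp add: conjugate_def)

lemma conjugate_one [simp]: "y \<in> carrier G \<Longrightarrow> conjugate G \<one> y = y"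
  by (simp add: conjugate_def)

lemma conjugate_mult_left:
  "x \<in> carrier G \<Longrightarrow> x' \<in> carrier G \<Longrightarrow> y \<in> carrier G \<Longrightarrow>
    conjugate G (x \<otimes> x') y = conjugate G x (conjugate G x' y)"
  by (simp add: conjugate_def m_assoc inv_mult_group)

lemma conjugate_inv:
  "x \<in> carrier G \<Longrightarrow> y \<in> carrier G \<Longrightarrow> conjugate G x (inv y) = inv (conjugate G x y)"
  by (simp add: conjugate_def m_assoc inv_mult_group)

lemma conjugate_inv_cancel [simp]:
  assumes "x \<in> carrier G" "y \<in> carrier G"
  shows "conjugate G (inv x) (conjugate G x y) = y" "conjugate G x (conjugate G (inv x) y) = y"
  using assms by (simp_all flip: conjugate_mult_left)

lemma conjugate_eq_self_iff:
  "x \<in> carrier G \<Longrightarrow> y \<in> carrier G \<Longrightarrow> conjugate G x y = y \<longleftrightarrow> x \<otimes> y = y \<otimes> x"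
  by (metis conjugate_def inv_solve_right m_closed)

lemma conjugate_eq_iff:
  "x \<in> carrier G \<Longrightarrow> y \<in> carrier G \<Longrightarrow> z \<in> carrier G \<Longrightarrow>
    conjugate G x y = z \<longleftrightarrow> x \<otimes> y = z \<otimes> x"
  by (metis conjugate_def inv_solve_right m_closed)

lemma mem_centralizer_iff:
  "g \<in> carrier G \<Longrightarrow> z \<in> centralizer G g \<longleftrightarrow> z \<in> carrier G \<and> conjugate G z g = g"
  by (auto simp: centralizer_def conjugate_eq_self_iff)

lemma subgroup_centralizer:
  assumes "g \<in> carrier G"
  shows "subgroup (centralizer G g) G"
proof (rule subgroupI)
  show "inv z \<in> centralizer G g" if "z \<in> centralizer G g" for z
    using that assms by (metis conjugate_inv_cancel(1) inv_closed mem_centralizer_iff)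
next
  have "\<one> \<in> centralizer G g"
    using assms by (simp add: mem_centralizer_iff)
  then show "centralizer G g \<noteq> {}" by blast
qed (use assms in \<open>auto simp: mem_centralizer_iff conjugate_mult_left\<close>)

lemma reverser_conjugate:
  assumes "reverser G g k" "x \<in> carrier G" "g \<in> carrier G"
  shows "reverser G (conjugate G x g) (conjugate G x k)"
proof -
  have k: "k \<in> carrier G" "conjugate G k g = inv g"
    using assms(1) by (auto simp: reverser_def)
  have "conjugate G x k \<otimes> x = x \<otimes> k"
    using assms k by (simp add: conjugate_def m_assoc)
  then have "conjugate G (conjugate G x k) (conjugate G x g) = conjugate G x (conjugate G k g)"
    using assms k by (metis conjugate_closed conjugate_mult_left)
  then show ?thesis
    using assms k by (simp add: reverser_def conjugate_inv)
qed

lemma reversible_conjugate_iff: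
  assumes "x \<in> carrier G" "g \<in> carrier G"
  shows "reversible G (conjugate G x g) \<longleftrightarrow> reversible G g"
  using assms reverser_conjugate[of g _ x] reverser_conjugate[of "conjugate G x g" _ "inv x"]
  by (auto simp: reversible_iff_reverser)

lemma involution_reversible: "g \<in> carrier G \<Longrightarrow> g \<otimes> g = \<one> \<Longrightarrow> reversible G g"
  unfolding reversible_iff_reverser reverser_def
  by (metis conjugate_one inv_equality one_closed)

text \<open>The squares in an infinite cyclic group form a subgroup of index two, and a generator serves
  as the nontrivial coset representative \<open>e\<close>.\<close>

lemma infinite_cyclic_squares:
  assumes H: "subgroup H G" and cyc: "infinite_cyclic G H"
  obtains e where "e \<in> H"
    and "\<And>x y. x \<in> H \<Longrightarrow> y \<in> H \<Longrightarrow> x \<otimes> y = y \<otimes> x"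
    and "\<And>w. w \<in> H \<Longrightarrow> w \<otimes> w = \<one> \<Longrightarrow> w = \<one>"
    and "\<And>w. w \<in> H \<Longrightarrow> w \<otimes> w \<noteq> e"
    and "\<And>z. z \<in> H \<Longrightarrow> \<exists>w\<in>H. z = w \<otimes> w \<or> z = e \<otimes> (w \<otimes> w)"
proof -
  interpret H: group "G\<lparr>carrier := H\<rparr>"
    using H by (rule subgroup_imp_group)
  obtain e where e: "e \<in> H" and HH: "H = range (\<lambda>n::int. e [^] n)"
  proof -
    obtain e where "e \<in> H" and HH: "H = range (\<lambda>n::int. e [^]\<^bsub>G\<lparr>carrier := H\<rparr>\<^esub> n)"
      using cyc H.cyclic_group by (auto simp: infinite_cyclic_def)
    moreover have "(\<lambda>n::int. e [^]\<^bsub>G\<lparr>carrier := H\<rparr>\<^esub> n) = (\<lambda>n::int. e [^] n)"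
      using int_pow_consistent[OF H \<open>e \<in> H\<close>] by simp
    ultimately show ?thesis
      using that by metis
  qed
  have eG: "e \<in> carrier G"
    using H e by (rule subgroup.mem_carrier)
  have "carrier (subgroup_generated G {e}) = H"
    unfolding HH by (rule carrier_subgroup_generated_by_singleton[OF eG])
  then have "infinite (carrier (subgroup_generated G {e}))"
    using cyc by (simp add: infinite_cyclic_def)
  then have inj: "e [^] i = e [^] j \<longleftrightarrow> i = j" for i j :: int
    unfolding infinite_cyclic_subgroup_int[OF eG] by auto
  have add: "e [^] i \<otimes> e [^] j = e [^] (i + j)" for i j :: int
    using eG by (simp add: int_pow_mult)
  have one: "e [^] (0::int) = \<one>" "e [^] (1::int) = e"
    using eG by simp_all
  have "\<exists>w\<in>H. z = w \<otimes> w \<or> z = e \<otimes> (w \<otimes> w)" if "z \<in> H" for z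
  proof -
    obtain n :: int where z: "z = e [^] n"
      using \<open>z \<in> H\<close> unfolding HH by blast
    have "e [^] (n div 2) \<in> H"
      using HH by auto
    moreover have "n = n div 2 + n div 2 \<or> n = 1 + (n div 2 + n div 2)"
      by presburger
    then have "z = e [^] (n div 2) \<otimes> e [^] (n div 2)
        \<or> z = e [^] (1::int) \<otimes> (e [^] (n div 2) \<otimes> e [^] (n div 2))"
      unfolding z add inj by blast
    ultimately show ?thesis
      unfolding one by blast
  qed
  moreover have "w \<otimes> w \<noteq> e" if w: "w \<in> H" for w
  proof -
    obtain n :: int where "w = e [^] n"
      using w unfolding HH by blast
    moreover have "n + n \<noteq> 1"
      by presburger
    ultimately show ?thesis
      using inj[of "n + n" 1] add one by simp
  qed
  moreover have "w = \<one>" if "w \<in> H" "w \<otimes> w = \<one>" for w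
  proof -
    obtain n :: int where w: "w = e [^] n"
      using \<open>w \<in> H\<close> unfolding HH by blast
    with \<open>w \<otimes> w = \<one>\<close> have "n = 0"
      using inj[of "n + n" 0] add one by simp
    with w show ?thesis by simp
  qed
  moreover have "x \<otimes> y = y \<otimes> x" if "x \<in> H" "y \<in> H" for x y
    using that unfolding HH by (auto simp: add add.commute)
  ultimately show ?thesis
    using that[OF e] by metis
qed

text \<open>The reversers of \<open>g\<close> form the coset \<open>Z k\<close> of the centralizer \<open>Z\<close> of \<open>g\<close>. If
  all of them are involutions, then they invert \<open>Z\<close>, so that conjugating a reverser \<open>k\<close> by
  \<open>w \<in> Z\<close> gives \<open>w\<^sup>2 k\<close>. When \<open>Z\<close> is infinite cyclic, this leaves
  exactly two \<open>Z\<close>-classes of reversers, and \<open>Z\<close> acts freely on each of them.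

  If \<open>k\<close> is conjugate to \<open>\<eta> f\<close>, then the elements \<open>x g x\<^sup>-\<^sup>1\<close> with \<open>x k x\<^sup>-\<^sup>1 = \<eta> f\<close> correspond
  to the elements of the centralizer of \<open>\<eta> f\<close>. As every element counted below arises in this
  way from exactly one of the two classes of reversers, the count is twice the order of these
  centralizers.\<close>

lemma card_conjugates_with_reverser:
  fixes \<eta> :: "'i \<Rightarrow> 'a"
  assumes g: "g \<in> carrier G" and cyc: "infinite_cyclic G (centralizer G g)"
    and rev: "reversible G g"
    and inv2: "\<And>k. reverser G g k \<Longrightarrow> k \<otimes> k = \<one>"
    and eta: "\<And>f. f \<in> F \<Longrightarrow> \<eta> f \<in> carrier G"
    and ex: "\<And>k. reverser G g k \<Longrightarrow> \<exists>x\<in>carrier G. conjugate G x k \<in> \<eta> ` F"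
    and distinct: "\<And>x f f'. x \<in> carrier G \<Longrightarrow> f \<in> F \<Longrightarrow> f' \<in> F \<Longrightarrow>
      conjugate G x (\<eta> f) = \<eta> f' \<Longrightarrow> f = f'"
    and cent: "\<And>f. f \<in> F \<Longrightarrow> card (centralizer G (\<eta> f)) = n" and n: "n > 0"
    and unique: "\<And>h f f'. h \<in> conjugacy_class G g \<Longrightarrow> f \<in> F \<Longrightarrow> f' \<in> F \<Longrightarrow>
      reverser G h (\<eta> f) \<Longrightarrow> reverser G h (\<eta> f') \<Longrightarrow> f = f'"
  shows "card {h \<in> conjugacy_class G g. \<exists>f\<in>F. reverser G h (\<eta> f)} = 2 * n"
proof -
  define Z where "Z = centralizer G g"
  have Z: "z \<in> Z \<longleftrightarrow> z \<in> carrier G \<and> conjugate G z g = g" for z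
    unfolding Z_def using g by (rule mem_centralizer_iff)
  have subZ: "subgroup Z G"
    unfolding Z_def using g by (rule subgroup_centralizer)
  have Zmult: "x \<otimes> y \<in> Z" if "x \<in> Z" "y \<in> Z" for x y
    using subZ that by (rule subgroup.m_closed)
  have Zcarr: "x \<in> carrier G" if "x \<in> Z" for x
    using Z that by blast
  obtain e where e: "e \<in> Z"
    and comm: "\<And>x y. x \<in> Z \<Longrightarrow> y \<in> Z \<Longrightarrow> x \<otimes> y = y \<otimes> x"
    and tf: "\<And>w. w \<in> Z \<Longrightarrow> w \<otimes> w = \<one> \<Longrightarrow> w = \<one>"
    and nonsq: "\<And>w. w \<in> Z \<Longrightarrow> w \<otimes> w \<noteq> e"
    and sq: "\<And>z. z \<in> Z \<Longrightarrow> \<exists>w\<in>Z. z = w \<otimes> w \<or> z = e \<otimes> (w \<otimes> w)"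
    by (rule infinite_cyclic_squares[OF subZ cyc[folded Z_def]], rule that)
  have Rcarr: "k \<in> carrier G" if "reverser G g k" for k
    using that by (simp add: reverser_def)
  have ZR: "reverser G g (z \<otimes> k)" if "z \<in> Z" "reverser G g k" for z k
  proof -
    have "z \<in> carrier G" "k \<in> carrier G" "conjugate G k g = inv g" "conjugate G z g = g"
      using that by (auto simp: reverser_def Z)
    then show ?thesis
      using g by (simp add: reverser_def conjugate_mult_left conjugate_inv)
  qed
  have RR: "k' \<otimes> inv k \<in> Z" if k: "reverser G g k" and k': "reverser G g k'" for k k'
  proof -
    have "conjugate G k (inv g) = g"
      using k g by (simp add: reverser_def conjugate_inv)
    then have "conjugate G (inv k) g = inv g"
      using k g by (metis Rcarr conjugate_inv_cancel(1) inv_closed)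
    then have "conjugate G (k' \<otimes> inv k) g = conjugate G k' (inv g)"
      using Rcarr[OF k] Rcarr[OF k'] g by (simp add: conjugate_mult_left)
    also have "\<dots> = g"
      using k' g by (simp add: reverser_def conjugate_inv)
    finally show ?thesis
      using Rcarr[OF k] Rcarr[OF k'] by (simp add: Z)
  qed
  \<comment> \<open>Both \<open>k\<close> and the reverser \<open>w k\<close> are involutions, hence \<open>k w\<^sup>-\<^sup>1 = w k\<close>.\<close>
  have conjZ: "conjugate G w k = w \<otimes> w \<otimes> k" if w: "w \<in> Z" and k: "reverser G g k" for w k
  proof -
    have [simp]: "w \<in> carrier G" "k \<in> carrier G"
      using w k Zcarr Rcarr by blast+
    have "(w \<otimes> k) \<otimes> (w \<otimes> k) = \<one>"
      using inv2[OF ZR[OF w k]] .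
    then have "inv (w \<otimes> k) = w \<otimes> k"
      by (simp add: inv_equality)
    moreover have "inv k = k"
      using inv2[OF k] by (simp add: inv_equality)
    ultimately have "k \<otimes> inv w = w \<otimes> k"
      by (simp add: inv_mult_group)
    then show ?thesis
      by (simp add: conjugate_def m_assoc)
  qed
  define S where "S = {h \<in> conjugacy_class G g. \<exists>f\<in>F. reverser G h (\<eta> f)}"
  define T where "T k = {conjugate G x g | x. x \<in> carrier G \<and> conjugate G x k \<in> \<eta> ` F}" for k
  obtain k0 where k0: "reverser G g k0"
    using rev by (auto simp: reversible_iff_reverser)
  define k1 where "k1 = e \<otimes> k0"
  have k1: "reverser G g k1"
    unfolding k1_def using e k0 by (rule ZR)
  \<comment> \<open>\<open>T k\<close> collects the conjugates of \<open>g\<close> that are counted because of the reverser \<open>k\<close>; it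
    depends only on the class of \<open>k\<close> under \<open>Z\<close>, so the two classes of reversers give two sets.\<close>
  have TS: "T k \<subseteq> S" if k: "reverser G g k" for k
    using reverser_conjugate[OF k _ g]
    by (fastforce simp: T_def S_def conjugacy_class_eq_conjugate)
  have cardT: "card (T k) = n" if k: "reverser G g k" for k
  proof -
    obtain x f where x: "x \<in> carrier G" and f: "f \<in> F" and xk: "conjugate G x k = \<eta> f"
      using ex[OF k] by blast
    have [simp]: "k \<in> carrier G" "\<eta> f \<in> carrier G"
      using k f Rcarr eta by blast+
    have "bij_betw (\<lambda>c. conjugate G (c \<otimes> x) g) (centralizer G (\<eta> f)) (T k)"
    proof (rule bij_betwI')
      fix c c' assume c: "c \<in> centralizer G (\<eta> f)" "c' \<in> centralizer G (\<eta> f)"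
      then have cc: "c \<in> carrier G" "c' \<in> carrier G"
        and ck: "conjugate G (c \<otimes> x) k = \<eta> f" "conjugate G (c' \<otimes> x) k = \<eta> f"
        using x xk by (auto simp: mem_centralizer_iff conjugate_mult_left)
      define z where "z = inv (c' \<otimes> x) \<otimes> (c \<otimes> x)"
      have zc: "z \<in> carrier G"
        using cc x by (simp add: z_def)
      have zz: "c \<otimes> x = (c' \<otimes> x) \<otimes> z"
        unfolding z_def using cc x by (metis inv_closed l_one m_assoc m_closed r_inv)
      show "conjugate G (c \<otimes> x) g = conjugate G (c' \<otimes> x) g \<longleftrightarrow> c = c'"
      proof
        assume eq: "conjugate G (c \<otimes> x) g = conjugate G (c' \<otimes> x) g"
        have "conjugate G z g = conjugate G (inv (c' \<otimes> x)) (conjugate G (c \<otimes> x) g)"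
          unfolding z_def using cc x g by (simp only: conjugate_mult_left m_closed inv_closed)
        then have "z \<in> Z"
          unfolding eq using zc cc x g by (simp add: Z)
        have "conjugate G z k = conjugate G (inv (c' \<otimes> x)) (conjugate G (c \<otimes> x) k)"
          unfolding z_def using cc x \<open>k \<in> carrier G\<close>
          by (simp only: conjugate_mult_left m_closed inv_closed)
        also have "\<dots> = k"
          unfolding ck(1) ck(2)[symmetric] using cc x by simp
        finally have "z \<otimes> z \<otimes> k = k"
          using conjZ[OF \<open>z \<in> Z\<close> k] by simp
        then have "z \<otimes> z = \<one>"
          using zc by (simp add: r_cancel_one')
        then have "z = \<one>"
          using tf \<open>z \<in> Z\<close> by blast
        then show "c = c'"
          using zz cc x by simp
      qed simp
    next
      fix c assume "c \<in> centralizer G (\<eta> f)"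
      then have "c \<otimes> x \<in> carrier G" "conjugate G (c \<otimes> x) k = \<eta> f"
        using x xk by (auto simp: mem_centralizer_iff conjugate_mult_left)
      then show "conjugate G (c \<otimes> x) g \<in> T k"
        unfolding T_def using f by blast
    next
      fix h assume "h \<in> T k"
      then obtain y f' where y: "y \<in> carrier G" and f': "f' \<in> F"
        and yk: "conjugate G y k = \<eta> f'" and h: "h = conjugate G y g"
        by (auto simp: T_def)
      have c: "conjugate G (y \<otimes> inv x) (\<eta> f) = \<eta> f'"
        using x y yk by (simp add: conjugate_mult_left flip: xk)
      then have "f = f'"
        using distinct f f' x y by (metis inv_closed m_closed)
      then have "y \<otimes> inv x \<in> centralizer G (\<eta> f)"
        using c x y f eta by (simp add: mem_centralizer_iff)
      moreover have "h = conjugate G ((y \<otimes> inv x) \<otimes> x) g"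
        using x y by (simp add: h m_assoc)
      ultimately show "\<exists>c\<in>centralizer G (\<eta> f). h = conjugate G (c \<otimes> x) g"
        by blast
    qed
    then show ?thesis
      using cent[OF f] bij_betw_same_card by metis
  qed
  have "S \<subseteq> T k0 \<union> T k1"
  proof
    fix h assume "h \<in> S"
    then obtain x f where x: "x \<in> carrier G" and h: "h = conjugate G x g" and f: "f \<in> F"
      and hf: "reverser G h (\<eta> f)"
      by (auto simp: S_def conjugacy_class_eq_conjugate)
    define k where "k = conjugate G (inv x) (\<eta> f)"
    have k: "reverser G g k"
      using reverser_conjugate[OF hf, of "inv x"] x g unfolding k_def h by simp
    have xk: "conjugate G x k = \<eta> f"
      using x f eta by (simp add: k_def)
    have [simp]: "k \<in> carrier G" "k0 \<in> carrier G"
      using k k0 Rcarr by blast+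
    have "k \<otimes> inv k0 \<in> Z"
      using k0 k by (rule RR)
    moreover have kk: "k = (k \<otimes> inv k0) \<otimes> k0"
      by (simp add: m_assoc)
    ultimately obtain w where w: "w \<in> Z" and wk: "k = w \<otimes> w \<otimes> k0 \<or> k = e \<otimes> (w \<otimes> w) \<otimes> k0"
      using sq by metis
    have "e \<otimes> (w \<otimes> w) \<otimes> k0 = w \<otimes> w \<otimes> k1"
      unfolding k1_def using comm[OF e Zmult[OF w w]] w e Zcarr by (simp add: m_assoc[symmetric])
    then have "k = conjugate G w k0 \<or> k = conjugate G w k1"
      using wk conjZ[OF w k0] conjZ[OF w k1] by auto
    then obtain k' where k': "k' = k0 \<or> k' = k1" and "k = conjugate G w k'"
      by blast
    moreover have "k' \<in> carrier G"
      using k' k0 k1 Rcarr by blast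
    ultimately have "conjugate G (x \<otimes> w) k' = \<eta> f" "h = conjugate G (x \<otimes> w) g"
      using x w g Z by (auto simp: conjugate_mult_left h xk[symmetric])
    then have "h \<in> T k'"
      unfolding T_def using f x w Zcarr by blast
    then show "h \<in> T k0 \<union> T k1"
      using k' by blast
  qed
  then have S: "S = T k0 \<union> T k1"
    using TS k0 k1 by blast
  \<comment> \<open>A common element would yield \<open>z \<in> Z\<close> carrying \<open>k0\<close> to \<open>k1 = e k0\<close>, making \<open>e\<close> a square.\<close>
  have "T k0 \<inter> T k1 = {}"
  proof (rule ccontr)
    assume "T k0 \<inter> T k1 \<noteq> {}"
    then obtain h where h: "h \<in> T k0" "h \<in> T k1"
      by blast
    obtain x f where x: "x \<in> carrier G" "h = conjugate G x g" and f: "f \<in> F" "conjugate G x k0 = \<eta> f"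
      using h(1) by (auto simp: T_def)
    obtain y f' where y: "y \<in> carrier G" "h = conjugate G y g"
      and f': "f' \<in> F" "conjugate G y k1 = \<eta> f'"
      using h(2) by (auto simp: T_def)
    have [simp]: "k0 \<in> carrier G" "k1 \<in> carrier G"
      using k0 k1 Rcarr by blast+
    have "h \<in> conjugacy_class G g"
      using x by (auto simp: conjugacy_class_eq_conjugate)
    moreover have "reverser G h (\<eta> f)" "reverser G h (\<eta> f')"
      using reverser_conjugate[OF k0 x(1) g] reverser_conjugate[OF k1 y(1) g] x y f f' by simp_all
    ultimately have "f = f'"
      using unique f f' by blast
    define z where "z = inv y \<otimes> x"
    have "conjugate G z g = conjugate G (inv y) (conjugate G y g)"
      unfolding z_def using x y g by (simp only: conjugate_mult_left inv_closed)
    then have z: "z \<in> Z"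
      using x y g by (simp add: Z z_def)
    have "conjugate G z k0 = conjugate G (inv y) (conjugate G y k1)"
      unfolding z_def using x y f f' \<open>f = f'\<close> by (simp only: conjugate_mult_left inv_closed \<open>k0 \<in> carrier G\<close>)
    then have "z \<otimes> z \<otimes> k0 = k1"
      using conjZ[OF z k0] y(1) by simp
    then have "z \<otimes> z \<otimes> k0 = e \<otimes> k0"
      by (simp add: k1_def)
    then have "z \<otimes> z = e"
      using z e Zcarr by (simp add: right_cancel)
    then show False
      using nonsq z by blast
  qed
  moreover have "finite (T k0)" "finite (T k1)"
    using cardT[OF k0] cardT[OF k1] n by (metis card.infinite less_irrefl)+
  ultimately have "card S = 2 * n"
    using cardT[OF k0] cardT[OF k1] by (simp add: S card_Un_disjoint)
  then show ?thesis
    unfolding S_def .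
qed

end

section \<open>Gaussian integers\<close>

lemma gauss_ints_simps [simp]:
  "0 \<in> gauss_ints" "1 \<in> gauss_ints" "\<i> \<in> gauss_ints" "numeral n \<in> gauss_ints"
  "x \<in> gauss_ints \<Longrightarrow> - x \<in> gauss_ints"
  "x \<in> gauss_ints \<Longrightarrow> cnj x \<in> gauss_ints"
  "x \<in> gauss_ints \<Longrightarrow> y \<in> gauss_ints \<Longrightarrow> x + y \<in> gauss_ints"
  "x \<in> gauss_ints \<Longrightarrow> y \<in> gauss_ints \<Longrightarrow> x - y \<in> gauss_ints"
  "x \<in> gauss_ints \<Longrightarrow> y \<in> gauss_ints \<Longrightarrow> x * y \<in> gauss_ints"
  by (simp_all add: gauss_ints_def)

lemma gauss_intsE:
  assumes "z \<in> gauss_ints"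
  obtains m n :: int where "z = Complex (of_int m) (of_int n)"
proof -
  have "Re z \<in> \<int>" "Im z \<in> \<int>"
    using assms by (simp_all add: gauss_ints_def)
  then obtain m n :: int where "Re z = of_int m" "Im z = of_int n"
    by (metis Ints_cases)
  then have "z = Complex (of_int m) (of_int n)"
    by (simp add: complex_eq_iff)
  then show ?thesis
    by (rule that)
qed

text \<open>The norm of a Gaussian integer as a natural number: both descents below (the Euclidean
  algorithm, and the reduction of elements of order three) are inductions on such a norm.\<close>

lemma gauss_norm_nat:
  assumes "z \<in> gauss_ints"
  obtains n :: nat where "(cmod z)\<^sup>2 = of_nat n"
proof -
  obtain a b :: int where z: "z = Complex (of_int a) (of_int b)"
    using assms by (rule gauss_intsE)
  have "(cmod z)\<^sup>2 = of_nat (nat (a\<^sup>2 + b\<^sup>2))"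
    by (simp add: z cmod_power2)
  then show ?thesis
    by (rule that)
qed

lemma gauss_norm_one:
  assumes z: "z \<in> gauss_ints" and norm: "(cmod z)\<^sup>2 = 1"
  shows "z \<in> {1, -1, \<i>, -\<i>}"
proof -
  obtain a b :: int where ab: "z = Complex (of_int a) (of_int b)"
    using z by (rule gauss_intsE)
  have "of_int (a\<^sup>2 + b\<^sup>2) = (1::real)"
    using norm by (simp add: ab cmod_power2)
  then have *: "a\<^sup>2 + b\<^sup>2 = 1"
    by linarith
  moreover have "a\<^sup>2 \<ge> 0" "b\<^sup>2 \<ge> 0"
    by simp_all
  ultimately have "a\<^sup>2 \<le> 1" "b\<^sup>2 \<le> 1"
    by linarith+
  then have "\<bar>a\<bar> \<le> 1" "\<bar>b\<bar> \<le> 1"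
    by (simp_all add: abs_square_le_1)
  then have "a \<in> {-1, 0, 1}" "b \<in> {-1, 0, 1}"
    by auto
  then show ?thesis
    using * by (auto simp: ab complex_eq_iff)
qed

lemma gauss_unit:
  assumes x: "x \<in> gauss_ints" and y: "y \<in> gauss_ints" and xy: "x * y = 1"
  shows "x \<in> {1, -1, \<i>, -\<i>}"
proof (rule gauss_norm_one[OF x])
  obtain m :: nat where m: "(cmod x)\<^sup>2 = of_nat m"
    using x by (rule gauss_norm_nat)
  obtain n :: nat where n: "(cmod y)\<^sup>2 = of_nat n"
    using y by (rule gauss_norm_nat)
  have "of_nat (m * n) = (cmod (x * y))\<^sup>2"
    by (simp add: m n norm_mult power_mult_distrib)
  then have "m * n = 1"
    using xy by (metis norm_one of_nat_eq_1_iff one_power2)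
  then show "(cmod x)\<^sup>2 = 1"
    by (simp add: m)
qed

text \<open>A square of side 1 centred at a Gaussian integer lies in the disc of squared radius 1/2 around
  its centre. That this bound is smaller than 1 makes the Euclidean algorithm terminate.\<close>

lemma gauss_round:
  obtains q where "q \<in> gauss_ints" "(cmod (z - q))\<^sup>2 \<le> 1 / 2"
proof -
  have half: "(x - of_int (round x))\<^sup>2 \<le> 1 / 4" for x :: real
  proof -
    have "\<bar>x - of_int (round x)\<bar> \<le> 1 / 2"
      using of_int_round_abs_le[of x] by linarith
    then have "\<bar>x - of_int (round x)\<bar>\<^sup>2 \<le> (1 / 2)\<^sup>2"
      by (intro power_mono) auto
    then show ?thesis
      by (simp add: power2_eq_square)
  qed
  define q where "q = Complex (of_int (round (Re z))) (of_int (round (Im z)))"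
  have "(cmod (z - q))\<^sup>2 \<le> 1 / 2"
    using half[of "Re z"] half[of "Im z"] by (simp add: q_def cmod_power2)
  moreover have "q \<in> gauss_ints"
    by (simp add: q_def gauss_ints_def)
  ultimately show ?thesis
    by (rule that[rotated])
qed

text \<open>The values of \<open>f\<close> in the theorem: representatives of \<open>\<int>[\<i>]\<close> modulo 2.\<close>

definition gauss_parities :: "complex set" where
  "gauss_parities = {0, 1, \<i>, 1 + \<i>}"

lemma gauss_parities_gauss [simp]: "f \<in> gauss_parities \<Longrightarrow> f \<in> gauss_ints"
  by (auto simp: gauss_parities_def)

lemma gauss_parity_ex:
  assumes "z \<in> gauss_ints"
  obtains f s where "f \<in> gauss_parities" "s \<in> gauss_ints" "z = f + 2 * s"
proof -
  obtain a b :: int where z: "z = Complex (of_int a) (of_int b)"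
    using assms by (rule gauss_intsE)
  define f where "f = Complex (of_int (a mod 2)) (of_int (b mod 2))"
  define s where "s = Complex (of_int (a div 2)) (of_int (b div 2))"
  have "real_of_int (n mod 2) + 2 * of_int (n div 2) = of_int n" for n :: int
  proof -
    have "real_of_int (n mod 2 + 2 * (n div 2)) = of_int n"
      by (simp only: mod_mult_div_eq)
    then show ?thesis
      by (simp only: of_int_add of_int_mult of_int_numeral)
  qed
  then have "z = f + 2 * s"
    by (simp add: z f_def s_def complex_eq_iff)
  moreover have "a mod 2 \<in> {0, 1}" "b mod 2 \<in> {0, 1}"
    by auto
  then have "f \<in> gauss_parities"
    by (auto simp: gauss_parities_def f_def complex_eq_iff)
  moreover have "s \<in> gauss_ints"
    by (simp add: s_def gauss_ints_def)
  ultimately show ?thesis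
    using that by blast
qed

lemma gauss_parity_unique:
  assumes "f \<in> gauss_parities" "f' \<in> gauss_parities" "s \<in> gauss_ints" "f - f' = 2 * s"
  shows "f = f'"
proof -
  have no_half: "2 * x \<noteq> 1" "- (2 * x) \<noteq> 1" if "x \<in> \<int>" for x :: real
  proof -
    obtain n :: int where n: "x = of_int n"
      using \<open>x \<in> \<int>\<close> by (rule Ints_cases)
    have "2 * n \<noteq> 1" "2 * n \<noteq> -1"
      by presburger+
    then show "2 * x \<noteq> 1" "- (2 * x) \<noteq> 1"
      unfolding n by linarith+
  qed
  have "Re s \<in> \<int>" "Im s \<in> \<int>"
    using assms(3) by (simp_all add: gauss_ints_def)
  moreover have "Re f - Re f' = 2 * Re s" "Im f - Im f' = 2 * Im s"
    using arg_cong[OF assms(4), of Re] arg_cong[OF assms(4), of Im] by simp_all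
  ultimately have "\<bar>Re f - Re f'\<bar> \<noteq> 1" "\<bar>Im f - Im f'\<bar> \<noteq> 1"
    using no_half[of "Re s"] no_half[of "Im s"] by (simp_all add: abs_if)
  moreover have "Re f \<in> {0, 1}" "Re f' \<in> {0, 1}" "Im f \<in> {0, 1}" "Im f' \<in> {0, 1}"
    using assms(1,2) unfolding gauss_parities_def by auto
  ultimately show ?thesis
    by (intro complex_eqI) auto
qed

section \<open>Elements of the Picard group as matrices up to sign\<close>

definition mat22 :: "complex \<Rightarrow> complex \<Rightarrow> complex \<Rightarrow> complex \<Rightarrow> complex^2^2" where
  "mat22 a b c d = vector [vector [a, b], vector [c, d]]"

text \<open>The element of the Picard group with lift \<open>(a, b; c, d)\<close>. Its four arguments are the matrix
  entries, so that identities in the group become identities between Gaussian integers.\<close>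

definition pm :: "complex \<Rightarrow> complex \<Rightarrow> complex \<Rightarrow> complex \<Rightarrow> (complex^2^2) set" where
  "pm a b c d = {mat22 a b c d, - mat22 a b c d}"

definition gauss_sl2 :: "complex \<Rightarrow> complex \<Rightarrow> complex \<Rightarrow> complex \<Rightarrow> bool" where
  "gauss_sl2 a b c d \<longleftrightarrow>
    a \<in> gauss_ints \<and> b \<in> gauss_ints \<and> c \<in> gauss_ints \<and> d \<in> gauss_ints \<and> a * d - b * c = 1"

lemma mat22_nth [simp]:
  "mat22 a b c d $ 1 $ 1 = a" "mat22 a b c d $ 1 $ 2 = b"
  "mat22 a b c d $ 2 $ 1 = c" "mat22 a b c d $ 2 $ 2 = d"
  by (simp_all add: mat22_def)

lemma mat22_mult:
  "mat22 a b c d ** mat22 a' b' c' d' =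
    mat22 (a * a' + b * c') (a * b' + b * d') (c * a' + d * c') (c * b' + d * d')"
  by (simp add: mat2_eq_iff mat2_mult)

lemma pm_eq_iff:
  "pm a b c d = pm a' b' c' d' \<longleftrightarrow>
    (a = a' \<and> b = b' \<and> c = c' \<and> d = d') \<or> (a = - a' \<and> b = - b' \<and> c = - c' \<and> d = - d')"
proof -
  have "- a = a' \<and> - b = b' \<and> - c = c' \<and> - d = d' \<longleftrightarrow>
      a = - a' \<and> b = - b' \<and> c = - c' \<and> d = - d'"
    by auto
  moreover have "pm a b c d = pm a' b' c' d' \<longleftrightarrow>
      mat22 a b c d = mat22 a' b' c' d' \<or> - mat22 a b c d = mat22 a' b' c' d'"
    unfolding pm_def doubleton_eq_iff by (metis minus_minus)
  ultimately show ?thesis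
    by (simp add: mat2_eq_iff)
qed

lemma carrier_Picard: "g \<in> carrier Picard \<longleftrightarrow> (\<exists>a b c d. gauss_sl2 a b c d \<and> g = pm a b c d)"
proof
  assume "g \<in> carrier Picard"
  then obtain A where A: "A \<in> carrier (SL2 gauss_ints)" and g: "g = {A, - A}"
    by (auto simp: Picard_def carrier_PSL2)
  have "mat22 (A $ 1 $ 1) (A $ 1 $ 2) (A $ 2 $ 1) (A $ 2 $ 2) = A"
    by (simp add: mat2_eq_iff)
  then have "g = pm (A $ 1 $ 1) (A $ 1 $ 2) (A $ 2 $ 1) (A $ 2 $ 2)"
    by (simp add: g pm_def)
  then show "\<exists>a b c d. gauss_sl2 a b c d \<and> g = pm a b c d"
    using A unfolding carrier_SL2_iff gauss_sl2_def by blast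
next
  assume "\<exists>a b c d. gauss_sl2 a b c d \<and> g = pm a b c d"
  then obtain a b c d where "gauss_sl2 a b c d" "g = pm a b c d"
    by blast
  moreover from this have "mat22 a b c d \<in> carrier (SL2 gauss_ints)"
    by (simp add: carrier_SL2_iff gauss_sl2_def)
  ultimately show "g \<in> carrier Picard"
    unfolding Picard_def carrier_PSL2 pm_def by blast
qed

lemma pm_in_Picard [simp]: "gauss_sl2 a b c d \<Longrightarrow> pm a b c d \<in> carrier Picard"
  unfolding carrier_Picard by blast

lemma Picard_elem_cases:
  assumes "g \<in> carrier Picard"
  obtains a b c d where "gauss_sl2 a b c d" "g = pm a b c d"
  using assms unfolding carrier_Picard by blast

lemma pm_mult:
  "pm a b c d \<otimes>\<^bsub>Picard\<^esub> pm a' b' c' d' =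
    pm (a * a' + b * c') (a * b' + b * d') (c * a' + d * c') (c * b' + d * d')"
proof -
  have neg: "- A ** B = - (A ** B)" "A ** - B = - (A ** B)" for A B :: "complex^2^2"
    by (simp_all add: mat2_eq_iff mat2_mult)
  have "{A, - A} \<otimes>\<^bsub>Picard\<^esub> {B, - B} = {A ** B, - (A ** B)}" for A B
    by (auto simp: Picard_def PSL2_def FactGroup_def set_mult_def neg)
  then show ?thesis
    by (simp add: pm_def mat22_mult)
qed

lemma pm_one: "\<one>\<^bsub>Picard\<^esub> = pm 1 0 0 1"
proof -
  have "mat22 1 0 0 1 = mat 1"
    by (simp add: mat2_eq_iff mat2_one)
  then show ?thesis
    by (simp add: Picard_def PSL2_def FactGroup_def pm_def)
qed

interpretation Picard: group Picard
  by (rule group_Picard)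

lemma gauss_sl2_inv: "gauss_sl2 a b c d \<Longrightarrow> gauss_sl2 d (- b) (- c) a"
  by (simp add: gauss_sl2_def mult.commute)

lemma pm_inv:
  assumes "gauss_sl2 a b c d"
  shows "inv\<^bsub>Picard\<^esub> pm a b c d = pm d (- b) (- c) a"
proof (rule Picard.inv_equality)
  have "d * a - b * c = 1"
    using assms by (simp add: gauss_sl2_def mult.commute)
  then show "pm d (- b) (- c) a \<otimes>\<^bsub>Picard\<^esub> pm a b c d = \<one>\<^bsub>Picard\<^esub>"
    by (simp add: pm_mult pm_one pm_eq_iff algebra_simps)
qed (use assms gauss_sl2_inv in auto)

lemma conjugate_pm:
  assumes "gauss_sl2 k l m n"
  shows "conjugate Picard (pm k l m n) (pm a b c d) =
    pm ((k * a + l * c) * n - (k * b + l * d) * m) ((k * b + l * d) * k - (k * a + l * c) * l)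
       ((m * a + n * c) * n - (m * b + n * d) * m) ((m * b + n * d) * k - (m * a + n * c) * l)"
  unfolding conjugate_def pm_inv[OF assms] pm_mult by simp

lemma gauss_sl2_conjugate:
  assumes "gauss_sl2 k l m n" "gauss_sl2 a b c d"
  shows "gauss_sl2 ((k * a + l * c) * n - (k * b + l * d) * m) ((k * b + l * d) * k - (k * a + l * c) * l)
       ((m * a + n * c) * n - (m * b + n * d) * m) ((m * b + n * d) * k - (m * a + n * c) * l)"
proof -
  have "k * n - l * m = 1" "a * d - b * c = 1"
    using assms by (auto simp: gauss_sl2_def)
  moreover have "((k * a + l * c) * n - (k * b + l * d) * m) * ((m * b + n * d) * k - (m * a + n * c) * l)
     - ((k * b + l * d) * k - (k * a + l * c) * l) * ((m * a + n * c) * n - (m * b + n * d) * m)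
     = (k * n - l * m)\<^sup>2 * (a * d - b * c)"
    by (simp add: algebra_simps power2_eq_square)
  ultimately show ?thesis
    using assms by (simp add: gauss_sl2_def)
qed

text \<open>The trace of an element is defined up to sign only, hence the squares.\<close>

lemma trace_square_conjugate:
  assumes x: "x \<in> carrier Picard" and eq: "conjugate Picard x (pm a b c d) = pm a' b' c' d'"
  shows "(a' + d')\<^sup>2 = (a + d)\<^sup>2"
proof -
  obtain k l m n where k: "gauss_sl2 k l m n" "x = pm k l m n"
    using x by (rule Picard_elem_cases)
  define t where "t = ((k * a + l * c) * n - (k * b + l * d) * m)
    + ((m * b + n * d) * k - (m * a + n * c) * l)"
  have "k * n - l * m = 1"
    using k(1) by (simp add: gauss_sl2_def)
  moreover have "t = (a + d) * (k * n - l * m)"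
    unfolding t_def by (simp add: algebra_simps)
  ultimately have "t = a + d"
    by simp
  moreover have "a' + d' = t \<or> a' + d' = - t"
    using eq unfolding k(2) conjugate_pm[OF k(1)] pm_eq_iff t_def by (elim disjE conjE) simp_all
  ultimately show ?thesis
    by (metis power2_minus)
qed

section \<open>Triangular forms\<close>

text \<open>Every point of the projective line over the Gaussian rationals is equivalent to infinity: the
  Euclidean algorithm turns the vector \<open>(x, y)\<close> into one with second coordinate 0, and a single
  division step \<open>(x, y) \<mapsto> (y, q y - x)\<close> is multiplication by a matrix of determinant 1.\<close>

lemma gauss_complete_to_sl2:
  assumes "x \<in> gauss_ints" "y \<in> gauss_ints"
  obtains k l m n where "gauss_sl2 k l m n" "m * x + n * y = 0"
proof -
  obtain N :: nat where N: "(cmod y)\<^sup>2 = of_nat N"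
    using assms(2) by (rule gauss_norm_nat)
  have "\<exists>k l m n. gauss_sl2 k l m n \<and> m * x + n * y = 0"
    using assms N
  proof (induction N arbitrary: x y rule: less_induct)
    case (less N)
    show ?case
    proof (cases "y = 0")
      case True
      then show ?thesis
        by (intro exI[of _ 1] exI[of _ 0]) (simp add: gauss_sl2_def)
    next
      case False
      obtain q where q: "q \<in> gauss_ints" "(cmod (x / y - q))\<^sup>2 \<le> 1 / 2"
        by (rule gauss_round)
      define r where "r = q * y - x"
      have r: "r \<in> gauss_ints"
        using q less.prems by (simp add: r_def)
      obtain M :: nat where M: "(cmod r)\<^sup>2 = of_nat M"
        using r by (rule gauss_norm_nat)
      have "r = - ((x / y - q) * y)"
        using False by (simp add: r_def field_simps)
      then have "(cmod r)\<^sup>2 = (cmod (x / y - q))\<^sup>2 * (cmod y)\<^sup>2"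
        by (simp add: norm_mult power_mult_distrib)
      also have "\<dots> \<le> 1 / 2 * (cmod y)\<^sup>2"
        using q by (intro mult_right_mono) auto
      also have "\<dots> < (cmod y)\<^sup>2"
        using False by simp
      finally have "M < N"
        using M less.prems by simp
      then obtain k l m n where IH: "gauss_sl2 k l m n" "m * y + n * r = 0"
        using less.IH[of M y r] M r less.prems by blast
      have "gauss_sl2 (- l) (k + l * q) (- n) (m + n * q)"
        using IH(1) q by (simp add: gauss_sl2_def algebra_simps)
      moreover have "- n * x + (m + n * q) * y = 0"
        using IH(2) by (simp add: r_def algebra_simps)
      ultimately show ?thesis
        by blast
    qed
  qed
  then show ?thesis
    using that by blast
qed

text \<open>An eigenvalue in \<open>\<int>[\<i>]\<close> has an eigenvector over \<open>\<int>[\<i>]\<close>, and the previous lemma moves its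
  direction to that of the first basis vector.\<close>

lemma conjugate_upper_triangular:
  assumes A: "gauss_sl2 a b c d" and lam: "lam \<in> gauss_ints" "lam\<^sup>2 - (a + d) * lam + 1 = 0"
  obtains x b' where "x \<in> carrier Picard"
    "conjugate Picard x (pm a b c d) = pm lam b' 0 (a + d - lam)" "gauss_sl2 lam b' 0 (a + d - lam)"
proof -
  have G: "a \<in> gauss_ints" "b \<in> gauss_ints" "c \<in> gauss_ints" "d \<in> gauss_ints"
    and det: "a * d - b * c = 1"
    using A by (auto simp: gauss_sl2_def)
  \<comment> \<open>The adjugate of the matrix minus \<open>lam\<close> has eigenvectors as columns; one of them is nonzero
    unless the matrix is scalar.\<close>
  have "\<exists>x y. x \<in> gauss_ints \<and> y \<in> gauss_ints \<and> (x \<noteq> 0 \<or> y \<noteq> 0)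
      \<and> a * x + b * y = lam * x \<and> c * x + d * y = lam * y"
  proof (cases "b = 0 \<and> lam = a")
    case False
    have "c * b + d * (lam - a) = lam * (lam - a)"
    proof -
      have "c * b + d * (lam - a) - lam * (lam - a)
          = - (lam\<^sup>2 - (a + d) * lam + 1) - ((a * d - b * c) - 1)"
        by (simp add: algebra_simps power2_eq_square)
      then show ?thesis
        using lam(2) det by simp
    qed
    then show ?thesis
      using False lam G by (intro exI[of _ b] exI[of _ "lam - a"]) (auto simp: algebra_simps)
  next
    case True
    show ?thesis
    proof (cases "lam = d \<and> c = 0")
      case False
      then show ?thesis
        using True lam G by (intro exI[of _ "lam - d"] exI[of _ c]) (auto simp: algebra_simps)
    next
      case True
      then show ?thesis
        using \<open>b = 0 \<and> lam = a\<close> by (intro exI[of _ 1] exI[of _ 0]) auto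
    qed
  qed
  then obtain x y where xy: "x \<in> gauss_ints" "y \<in> gauss_ints" "x \<noteq> 0 \<or> y \<noteq> 0"
    "a * x + b * y = lam * x" "c * x + d * y = lam * y"
    by blast
  obtain k l m n where K: "gauss_sl2 k l m n" and mn: "m * x + n * y = 0"
    using gauss_complete_to_sl2[OF xy(1,2)] .
  have detK: "k * n - l * m = 1"
    using K by (simp add: gauss_sl2_def)
  \<comment> \<open>The vector \<open>(n, - m)\<close> is the primitive vector of which \<open>(x, y)\<close> is the multiple by \<open>g\<close>.\<close>
  define g where "g = k * x + l * y"
  have "g * n = x * (k * n - l * m) + l * (m * x + n * y)"
    "- (g * m) = y * (k * n - l * m) - k * (m * x + n * y)"
    by (simp_all add: g_def algebra_simps)
  then have gn: "x = g * n" and gm: "y = - (g * m)"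
    using detK mn by simp_all
  have "g \<noteq> 0"
    using gn gm xy(3) by auto
  have "g * (a * n - b * m) = g * (lam * n)" "g * (c * n - d * m) = g * (- lam * m)"
    using xy(4,5) unfolding gn gm by (simp_all add: algebra_simps)
  then have e: "a * n - b * m = lam * n" "c * n - d * m = - lam * m"
    unfolding mult_cancel_left using \<open>g \<noteq> 0\<close> by blast+
  define b' where "b' = (k * b + l * d) * k - (k * a + l * c) * l"
  have "(k * a + l * c) * n - (k * b + l * d) * m = k * (a * n - b * m) + l * (c * n - d * m)"
    by (simp add: algebra_simps)
  also have "\<dots> = lam * (k * n - l * m)"
    unfolding e by (simp add: algebra_simps)
  finally have e11: "(k * a + l * c) * n - (k * b + l * d) * m = lam"
    using detK by simp
  have "(m * a + n * c) * n - (m * b + n * d) * m = m * (a * n - b * m) + n * (c * n - d * m)"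
    by (simp add: algebra_simps)
  then have e21: "(m * a + n * c) * n - (m * b + n * d) * m = 0"
    unfolding e by (simp add: algebra_simps)
  have "(m * b + n * d) * k - (m * a + n * c) * l
      = (a + d) * (k * n - l * m) - ((k * a + l * c) * n - (k * b + l * d) * m)"
    by (simp add: algebra_simps)
  then have e22: "(m * b + n * d) * k - (m * a + n * c) * l = a + d - lam"
    unfolding e11 using detK by simp
  have "conjugate Picard (pm k l m n) (pm a b c d) = pm lam b' 0 (a + d - lam)"
    "gauss_sl2 lam b' 0 (a + d - lam)"
    using conjugate_pm[OF K, of a b c d] gauss_sl2_conjugate[OF K A]
    unfolding e11 e21 e22 b'_def by simp_all
  then show ?thesis
    using K by (intro that[of "pm k l m n" b']) simp_all
qed

section \<open>Reversers of Gaussian matrices\<close>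

text \<open>The half-turn \<open>z \<mapsto> f - z\<close>, which fixes infinity and \<open>f / 2\<close>.\<close>

definition eta :: "complex \<Rightarrow> (complex^2^2) set" where
  "eta f = pm \<i> (- (\<i> * f)) 0 (- \<i>)"

lemma gauss_sl2_eta: "f \<in> gauss_ints \<Longrightarrow> gauss_sl2 \<i> (- (\<i> * f)) 0 (- \<i>)"
  by (simp add: gauss_sl2_def)

lemma eta_in_Picard [simp]: "f \<in> gauss_ints \<Longrightarrow> eta f \<in> carrier Picard"
  unfolding eta_def by (intro pm_in_Picard gauss_sl2_eta)

lemma reverser_pm_iff:
  assumes "gauss_sl2 a b c d" "gauss_sl2 p q r s"
  shows "reverser Picard (pm a b c d) (pm p q r s) \<longleftrightarrow>
    pm (p * a + q * c) (p * b + q * d) (r * a + s * c) (r * b + s * d) =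
    pm (d * p - b * r) (d * q - b * s) (a * r - c * p) (a * s - c * q)"
proof -
  have "reverser Picard (pm a b c d) (pm p q r s) \<longleftrightarrow>
      pm p q r s \<otimes>\<^bsub>Picard\<^esub> pm a b c d = pm d (- b) (- c) a \<otimes>\<^bsub>Picard\<^esub> pm p q r s"
    unfolding reverser_def pm_inv[OF assms(1)]
    using assms gauss_sl2_inv[OF assms(1)] by (simp add: Picard.conjugate_eq_iff)
  also have "\<dots> \<longleftrightarrow> pm (p * a + q * c) (p * b + q * d) (r * a + s * c) (r * b + s * d) =
    pm (d * p - b * r) (d * q - b * s) (a * r - c * p) (a * s - c * q)"
    unfolding pm_mult by simp
  finally show ?thesis .
qed

text \<open>A lift \<open>H\<close> of a reverser of \<open>A\<close> satisfies \<open>H A = \<plusminus> A\<^sup>-\<^sup>1 H\<close>. The minus sign would give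
  \<open>tr A = - tr A\<close>. With the plus sign, \<open>A\<^sup>-\<^sup>1\<close> being the adjugate of \<open>A\<close>, the matrix equation says that
  \<open>H\<close> has trace 0 and is orthogonal to \<open>A\<close> in the trace form.\<close>

lemma reverser_trace_zero:
  assumes A: "gauss_sl2 a b c d" and H: "gauss_sl2 p q r s"
    and rev: "reverser Picard (pm a b c d) (pm p q r s)"
    and tr: "a + d \<noteq> 0" and c: "c \<noteq> 0"
  shows "s = - p" "p * (a - d) + q * c + b * r = 0"
proof -
  from rev consider
    (plus) "p * a + q * c = d * p - b * r" "r * a + s * c = a * r - c * p"
  | (minus) "p * a + q * c = - (d * p - b * r)" "p * b + q * d = - (d * q - b * s)"
      "r * a + s * c = - (a * r - c * p)" "r * b + s * d = - (a * s - c * q)"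
    unfolding reverser_pm_iff[OF A H] pm_eq_iff by blast
  then have *: "p * a + q * c = d * p - b * r \<and> r * a + s * c = a * r - c * p"
  proof cases
    case minus
    \<comment> \<open>This is the trace of \<open>H A\<close> times the adjugate of \<open>H\<close>.\<close>
    have "(a + d) * (p * s - q * r) = s * (p * a + q * c) - r * (p * b + q * d)
        - q * (r * a + s * c) + p * (r * b + s * d)"
      by (simp add: algebra_simps)
    also have "\<dots> = - ((a + d) * (p * s - q * r))"
      unfolding minus by (simp add: algebra_simps)
    finally have "(a + d) * (p * s - q * r) = 0"
      by simp
    then show ?thesis
      using tr H by (simp add: gauss_sl2_def)
  qed simp
  then have "c * (s + p) = 0"
    by (simp add: algebra_simps)
  then show "s = - p"
    using c by (simp add: eq_neg_iff_add_eq_0)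
  show "p * (a - d) + q * c + b * r = 0"
    using * by (simp add: algebra_simps)
qed

text \<open>The form \<open>a - d = f c\<close> of the condition covers upper triangular matrices with equal diagonal
  entries as well, where \<open>f\<close> may be 0.\<close>

lemma eta_reverser:
  assumes A: "gauss_sl2 a b c d" and f: "f \<in> gauss_ints" and eq: "a - d = f * c"
  shows "reverser Picard (pm a b c d) (eta f)"
proof -
  have a: "a = d + f * c"
    using eq by (simp add: algebra_simps)
  show ?thesis
    unfolding eta_def reverser_pm_iff[OF A gauss_sl2_eta[OF f]] pm_eq_iff
    by (simp add: a algebra_simps)
qed

lemma f_of_pm: "f_of (pm a b c d) = (a - d) / c"
  by (simp add: pm_def PSL2_lift)

lemma eta_reverser_iff_f_of:
  assumes A: "gauss_sl2 a b c d" and f: "f \<in> gauss_ints" and "a + d \<noteq> 0" "c \<noteq> 0"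
  shows "reverser Picard (pm a b c d) (eta f) \<longleftrightarrow> f_of (pm a b c d) = f"
proof
  assume "reverser Picard (pm a b c d) (eta f)"
  then have "\<i> * (a - d) + - (\<i> * f) * c + b * 0 = 0"
    unfolding eta_def using reverser_trace_zero[OF A gauss_sl2_eta[OF f]] assms by blast
  then have "\<i> * (a - d) = \<i> * (f * c)"
    by (simp add: algebra_simps)
  then have "a - d = f * c"
    unfolding mult_cancel_left by simp
  then show "f_of (pm a b c d) = f"
    using \<open>c \<noteq> 0\<close> by (simp add: f_of_pm)
next
  assume "f_of (pm a b c d) = f"
  then have "a - d = f * c"
    using \<open>c \<noteq> 0\<close> by (auto simp: f_of_pm)
  then show "reverser Picard (pm a b c d) (eta f)"
    by (rule eta_reverser[OF A f])
qed

section \<open>Involutions\<close>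

lemma pm_involution: "gauss_sl2 p q r (- p) \<Longrightarrow> pm p q r (- p) \<otimes>\<^bsub>Picard\<^esub> pm p q r (- p) = \<one>\<^bsub>Picard\<^esub>"
proof -
  assume "gauss_sl2 p q r (- p)"
  then have "- (p * (- p) - q * r) = -1"
    by (simp add: gauss_sl2_def)
  then have "p * p + q * r = -1" "r * q + - p * - p = -1"
    by (simp_all add: algebra_simps)
  then show ?thesis
    unfolding pm_mult pm_one pm_eq_iff by (intro disjI2) simp
qed

text \<open>A matrix of trace 0 and determinant 1 has the eigenvalue \<open>\<i>\<close>, so it becomes upper triangular with
  diagonal \<open>(\<i>, - \<i>)\<close>: a half-turn \<open>z \<mapsto> w - z\<close> with \<open>w \<in> \<int>[\<i>]\<close>. Conjugation by the translation by
  \<open>s\<close> replaces \<open>w\<close> by \<open>w + 2 s\<close>.\<close>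

lemma involution_conjugate_eta:
  assumes H: "gauss_sl2 p q r (- p)"
  obtains x f where "x \<in> carrier Picard" "f \<in> gauss_parities"
    "conjugate Picard x (pm p q r (- p)) = eta f"
proof -
  have i: "\<i> \<in> gauss_ints" "\<i>\<^sup>2 - (p + - p) * \<i> + 1 = 0"
    by simp_all
  obtain x b where x: "x \<in> carrier Picard"
    and xH: "conjugate Picard x (pm p q r (- p)) = pm \<i> b 0 (p + - p - \<i>)"
    and b: "gauss_sl2 \<i> b 0 (p + - p - \<i>)"
    using conjugate_upper_triangular[OF H i] by blast
  have "\<i> * b \<in> gauss_ints"
    using b by (simp add: gauss_sl2_def)
  then obtain f s where f: "f \<in> gauss_parities" and s: "s \<in> gauss_ints" and eq: "\<i> * b = f + 2 * s"
    by (rule gauss_parity_ex)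
  define y where "y = pm 1 (- s) 0 1"
  have ysl: "gauss_sl2 1 (- s) 0 1"
    using s by (simp add: gauss_sl2_def)
  then have y: "y \<in> carrier Picard"
    by (simp add: y_def)
  have "b + 2 * (\<i> * s) = - (\<i> * f)"
  proof -
    have f': "f = \<i> * b - 2 * s"
      using eq by simp
    show ?thesis
      unfolding f' by (simp add: algebra_simps)
  qed
  then have "conjugate Picard y (pm \<i> b 0 (- \<i>)) = eta f"
    unfolding y_def conjugate_pm[OF ysl] eta_def by (simp add: algebra_simps)
  then have "conjugate Picard (y \<otimes>\<^bsub>Picard\<^esub> x) (pm p q r (- p)) = eta f"
    using x y H xH by (simp add: Picard.conjugate_mult_left)
  then show ?thesis
    using that[of "y \<otimes>\<^bsub>Picard\<^esub> x" f] x y f by simp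
qed

text \<open>The hypotheses \<open>r\<close> and \<open>q\<close> are two entries of the equation \<open>X E' = E X\<close> for
  \<open>X = (p, q; r, s)\<close> and for the lifts \<open>E\<close>, \<open>E'\<close> of \<open>eta f\<close>, \<open>eta f'\<close> with upper left entry \<open>\<i>\<close>. Such an
  \<open>X\<close> is upper triangular with units on the diagonal, hence acts as \<open>z \<mapsto> \<plusminus> z + v\<close> with \<open>v \<in> \<int>[\<i>]\<close> and maps
  the fixed point \<open>f' / 2\<close> to \<open>f / 2\<close>. So \<open>f \<equiv> f'\<close> modulo 2, which determines \<open>f\<close>, and only the
  identity and the half-turn remain.\<close>

lemma eta_intertwiner:
  assumes H: "gauss_sl2 p q r s" and f: "f \<in> gauss_parities" "f' \<in> gauss_parities"
    and r: "\<i> * r = - (\<i> * r)" and q: "- (\<i> * f' * p) - \<i> * q = \<i> * q - \<i> * f * s"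
  shows "f = f' \<and> (pm p q r s = \<one>\<^bsub>Picard\<^esub> \<or> pm p q r s = eta f)"
proof -
  have r0: "r = 0"
    using r by simp
  have ps: "p * s = 1" and G: "p \<in> gauss_ints" "s \<in> gauss_ints" "q \<in> gauss_ints"
    using H r0 by (auto simp: gauss_sl2_def)
  have "\<i> * (2 * q) = \<i> * (f * s - f' * p)"
    using q by (simp add: algebra_simps)
  then have q2: "f * s - f' * p = 2 * q"
    unfolding mult_cancel_left by simp
  have p: "p \<in> {1, -1, \<i>, - \<i>}"
    using G ps by (intro gauss_unit)
  then have "p * s = p * cnj p" "p \<noteq> 0"
    using ps by auto
  then have s: "s = cnj p"
    by simp
  have "\<exists>t\<in>gauss_ints. f - f' = 2 * t"
  proof -
    have "p * (f * s - f' * p) = f * (p * s) - f' * (p * p)"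
      by (simp add: algebra_simps)
    then have *: "f - f' * (p * p) = 2 * (p * q)"
      unfolding ps q2 by (simp add: mult.left_commute)
    have "p * p = 1 \<or> p * p = -1"
      using p by auto
    then show ?thesis
    proof
      assume "p * p = 1"
      then show ?thesis
        using * G by (intro bexI[of _ "p * q"]) auto
    next
      assume "p * p = -1"
      then have "f - f' = 2 * (p * q - f')"
        using * by (simp add: algebra_simps)
      then show ?thesis
        using G f by (intro bexI[of _ "p * q - f'"]) auto
    qed
  qed
  then have ff: "f = f'"
    using gauss_parity_unique f by blast
  have q': "2 * q = f * (s - p)"
    using q2 ff by (simp add: algebra_simps)
  have "pm p q r s = pm 1 0 0 1 \<or> pm p q r s = eta f"
  proof (cases "p = 1 \<or> p = -1")
    case True
    then have "q = 0" "s = p"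
      using q' s by auto
    then show ?thesis
      using True r0 by (auto simp: pm_eq_iff)
  next
    case False
    then have "p = \<i> \<or> p = - \<i>"
      using p by blast
    moreover have "q = - (p * f)" "s = - p"
    proof -
      show "s = - p"
        using \<open>p = \<i> \<or> p = - \<i>\<close> s by auto
      then have "2 * q = 2 * (- (p * f))"
        using q' by (simp add: algebra_simps)
      then show "q = - (p * f)"
        unfolding mult_cancel_left by simp
    qed
    ultimately show ?thesis
      using r0 by (auto simp: pm_eq_iff eta_def)
  qed
  then show ?thesis
    using ff by (simp add: pm_one)
qed

text \<open>For each of the four half-turns there is an involution that interchanges its fixed points
  infinity and \<open>f / 2\<close>. Its lift \<open>T\<close> anticommutes with the lift \<open>E\<close> of the half-turn, so that \<open>E\<close> and \<open>- E\<close> are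
  conjugate; the equation \<open>2 p = f r\<close> expresses this.\<close>

lemma eta_swap_ex:
  assumes "f \<in> gauss_parities"
  obtains p q r where "gauss_sl2 p q r (- p)" "r \<noteq> 0" "2 * p = f * r"
proof -
  have "\<exists>p q r. gauss_sl2 p q r (- p) \<and> r \<noteq> 0 \<and> 2 * p = f * r"
  proof (cases "f = 0")
    case True
    then show ?thesis
      by (intro exI[of _ 0] exI[of _ 1] exI[of _ "-1"]) (simp add: gauss_sl2_def)
  next
    case False
    then consider "f = 1" | "f = \<i>" | "f = 1 + \<i>"
      using assms by (auto simp: gauss_parities_def)
    then show ?thesis
    proof cases
      case 1
      then show ?thesis
        by (intro exI[of _ \<i>] exI[of _ 0] exI[of _ "2 * \<i>"]) (simp add: gauss_sl2_def)
    next
      case 2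
      then show ?thesis
        by (intro exI[of _ \<i>] exI[of _ 0] exI[of _ 2]) (simp add: gauss_sl2_def)
    next
      case 3
      have "1 + \<i> \<noteq> 0"
        by (simp add: complex_eq_iff)
      then show ?thesis
        using 3 by (intro exI[of _ \<i>] exI[of _ 0] exI[of _ "1 + \<i>"]) (simp add: gauss_sl2_def algebra_simps)
    qed
  qed
  then show ?thesis
    using that by blast
qed

text \<open>An equation between elements of the group is one between matrices up to sign. The plus sign is
  the case of the preceding lemma on intertwining matrices, and multiplication by the swapping
  involution \<open>t\<close> reduces the minus sign to the plus sign. Hence the four half-turns are pairwise not
  conjugate, and each centralizer is a Klein four-group.\<close>

lemma conjugate_eta_eq_eta:
  assumes x: "x \<in> carrier Picard" and f: "f \<in> gauss_parities" "f' \<in> gauss_parities"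
    and eq: "conjugate Picard x (eta f') = eta f"
    and t: "t = pm p q r (- p)" "gauss_sl2 p q r (- p)" "2 * p = f * r"
  shows "f = f' \<and> x \<in> {\<one>\<^bsub>Picard\<^esub>, eta f, t, t \<otimes>\<^bsub>Picard\<^esub> eta f}"
proof -
  obtain k l m n where K: "gauss_sl2 k l m n" and xK: "x = pm k l m n"
    using x by (rule Picard_elem_cases)
  have "x \<otimes>\<^bsub>Picard\<^esub> eta f' = eta f \<otimes>\<^bsub>Picard\<^esub> x"
    using eq x f by (simp add: Picard.conjugate_eq_iff)
  then have "pm (\<i> * k) (- (\<i> * f' * k) - \<i> * l) (\<i> * m) (- (\<i> * f' * m) - \<i> * n) =
      pm (\<i> * k - \<i> * f * m) (\<i> * l - \<i> * f * n) (- (\<i> * m)) (- (\<i> * n))"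
    unfolding xK eta_def pm_mult by (simp add: algebra_simps minus_diff_commute)
  then consider
    (plus) "- (\<i> * f' * k) - \<i> * l = \<i> * l - \<i> * f * n" "\<i> * m = - (\<i> * m)"
  | (minus) "\<i> * k = - (\<i> * k - \<i> * f * m)" "- (\<i> * f' * k) - \<i> * l = - (\<i> * l - \<i> * f * n)"
      "- (\<i> * f' * m) - \<i> * n = - (- (\<i> * n))"
    unfolding pm_eq_iff by blast
  then show ?thesis
  proof cases
    case plus
    then show ?thesis
      using eta_intertwiner[OF K f] unfolding xK by auto
  next
    case minus
    have "\<i> * (2 * k) = \<i> * (f * m)" "\<i> * (- (f' * k)) = \<i> * (f * n)" "\<i> * (2 * n) = \<i> * (- (f' * m))"
      using minus by (simp_all add: algebra_simps)
    then have k: "2 * k = f * m" and nk: "- (f' * k) = f * n" and n: "2 * n = - (f' * m)"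
      unfolding mult_cancel_left by simp_all
    from nk have fk: "f' * k = - (f * n)"
      by (metis minus_minus)
    have tin: "t \<in> carrier Picard"
      using t by simp
    have tt: "t \<otimes>\<^bsub>Picard\<^esub> t = \<one>\<^bsub>Picard\<^esub>"
      unfolding t(1) using t(2) by (rule pm_involution)
    define p' q' r' s' where "p' = p * k + q * m" and "q' = p * l + q * n"
      and "r' = r * k - p * m" and "s' = r * l - p * n"
    have tx: "t \<otimes>\<^bsub>Picard\<^esub> x = pm p' q' r' s'"
      by (simp add: t xK pm_mult p'_def q'_def r'_def s'_def)
    have "p' * s' - q' * r' = (- (p * p) - q * r) * (k * n - l * m)"
      by (simp add: p'_def q'_def r'_def s'_def algebra_simps)
    then have sl: "gauss_sl2 p' q' r' s'"
      using t(2) K by (simp add: gauss_sl2_def p'_def q'_def r'_def s'_def)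
    have "2 * r' = r * (2 * k) - (2 * p) * m"
      by (simp add: r'_def algebra_simps)
    then have r'0: "r' = 0"
      unfolding k t(3) by simp
    have "f' * p' + 2 * q' - f * s' = p * (f' * k) + f' * q * m + (2 * p) * l + q * (2 * n) - f * r * l + f * p * n"
      by (simp add: p'_def q'_def s'_def algebra_simps)
    also have "\<dots> = 0"
      unfolding fk n t(3) by (simp add: algebra_simps)
    finally have q'0: "f' * p' + 2 * q' - f * s' = 0" .
    have "(\<i> * q' - \<i> * f * s') - (- (\<i> * f' * p') - \<i> * q') = \<i> * (f' * p' + 2 * q' - f * s')"
      by (simp add: algebra_simps)
    then have "- (\<i> * f' * p') - \<i> * q' = \<i> * q' - \<i> * f * s'"
      by (simp only: q'0 mult_zero_right right_minus_eq)
    then have "f = f' \<and> (t \<otimes>\<^bsub>Picard\<^esub> x = \<one>\<^bsub>Picard\<^esub> \<or> t \<otimes>\<^bsub>Picard\<^esub> x = eta f)"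
      unfolding tx using r'0 by (intro eta_intertwiner[OF sl f]) simp_all
    moreover have "x = t \<otimes>\<^bsub>Picard\<^esub> (t \<otimes>\<^bsub>Picard\<^esub> x)"
      using tin x tt by (simp flip: Picard.m_assoc)
    ultimately show ?thesis
      using tin by (metis Picard.r_one insertCI)
  qed
qed

lemma card_centralizer_eta:
  assumes f: "f \<in> gauss_parities"
  shows "card (centralizer Picard (eta f)) = 4"
proof -
  obtain p q r where T: "gauss_sl2 p q r (- p)" and r: "r \<noteq> 0" and pr: "2 * p = f * r"
    using f by (rule eta_swap_ex)
  define t where "t = pm p q r (- p)"
  have t: "t \<in> carrier Picard"
    using T by (simp add: t_def)
  have e: "eta f \<in> carrier Picard"
    using f by simp
  have eqs: "\<i> * p = - (\<i> * p - \<i> * f * r)" "- (\<i> * f * r) + \<i> * p = - (\<i> * p)"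
  proof -
    have "\<i> * (2 * p) = \<i> * (f * r)"
      unfolding pr ..
    then show "\<i> * p = - (\<i> * p - \<i> * f * r)" "- (\<i> * f * r) + \<i> * p = - (\<i> * p)"
      by (simp_all add: algebra_simps)
  qed
  have te: "t \<otimes>\<^bsub>Picard\<^esub> eta f = eta f \<otimes>\<^bsub>Picard\<^esub> t"
    unfolding t_def eta_def pm_mult pm_eq_iff using eqs by (intro disjI2) (simp add: algebra_simps)
  have "centralizer Picard (eta f) = {\<one>\<^bsub>Picard\<^esub>, eta f, t, t \<otimes>\<^bsub>Picard\<^esub> eta f}"
  proof
    show "centralizer Picard (eta f) \<subseteq> {\<one>\<^bsub>Picard\<^esub>, eta f, t, t \<otimes>\<^bsub>Picard\<^esub> eta f}"
      using conjugate_eta_eq_eta[OF _ f f _ t_def T pr]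
      unfolding Picard.mem_centralizer_iff[OF e] subset_iff by blast
    have "subgroup (centralizer Picard (eta f)) Picard"
      using e by (rule Picard.subgroup_centralizer)
    moreover have "eta f \<in> centralizer Picard (eta f)" "t \<in> centralizer Picard (eta f)"
      using e t te by (simp_all add: centralizer_def)
    ultimately show "{\<one>\<^bsub>Picard\<^esub>, eta f, t, t \<otimes>\<^bsub>Picard\<^esub> eta f} \<subseteq> centralizer Picard (eta f)"
      by (simp add: subgroup.one_closed subgroup.m_closed)
  qed
  moreover have "\<i> \<noteq> 1" "\<i> \<noteq> -1"
    by (simp_all add: complex_eq_iff)
  then have "\<one>\<^bsub>Picard\<^esub> \<noteq> eta f"
    by (simp add: pm_one eta_def pm_eq_iff)
  moreover have "t \<noteq> \<one>\<^bsub>Picard\<^esub>" "t \<noteq> eta f"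
    "t \<otimes>\<^bsub>Picard\<^esub> eta f \<noteq> \<one>\<^bsub>Picard\<^esub>" "t \<otimes>\<^bsub>Picard\<^esub> eta f \<noteq> eta f"
    using r unfolding t_def eta_def pm_one pm_mult pm_eq_iff by simp_all
  moreover have "t \<otimes>\<^bsub>Picard\<^esub> eta f \<noteq> t"
    using \<open>\<one>\<^bsub>Picard\<^esub> \<noteq> eta f\<close> t e by (simp add: Picard.l_cancel_one)
  ultimately show ?thesis
    by (simp add: card_insert_if)
qed

section \<open>Fixed points and traces\<close>

text \<open>The diagonal entries are inverse units of \<open>\<int>[\<i>]\<close>: \<open>\<plusminus> (1, 1)\<close> or \<open>\<plusminus> (\<i>, - \<i>)\<close>.\<close>

lemma gauss_sl2_lower_zero:
  assumes "gauss_sl2 a b 0 d"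
  shows "a + d = 0 \<or> a = d \<and> (a = 1 \<or> a = -1)"
proof -
  have ad: "a * d = 1" and "a \<in> gauss_ints" "d \<in> gauss_ints"
    using assms by (simp_all add: gauss_sl2_def)
  then have a: "a \<in> {1, -1, \<i>, -\<i>}"
    by (intro gauss_unit)
  then have "a * d = a * cnj a" "a \<noteq> 0"
    using ad by auto
  then have "d = cnj a"
    by simp
  then show ?thesis
    using a by auto
qed

lemma invariants_H3_iff:
  "x \<in> invariants H3 act_H3 (pm a b c d) \<longleftrightarrow> x \<in> H3 \<and> poincare_ext (mat22 a b c d) x = x"
  by (simp add: invariants_def pm_def PSL2_lift)

lemma invariants_sphere_iff:
  "p \<in> invariants UNIV act_sphere (pm a b c d) \<longleftrightarrow> moebius (mat22 a b c d) p = p"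
  by (simp add: invariants_def pm_def PSL2_lift)

lemma one_elliptic: "elliptic (pm 1 0 0 1)"
proof -
  have "(0, 1) \<in> invariants H3 act_H3 (pm 1 0 0 1)"
    unfolding invariants_H3_iff by (simp add: H3_def poincare_ext_def)
  then show ?thesis
    unfolding elliptic_def by blast
qed

text \<open>For \<open>c \<noteq> 0\<close> the fixed point is the highest point of the isometric hemisphere, which a half-turn
  maps to itself; for \<open>c = 0\<close> it is any point on the axis above the finite fixed point.\<close>

lemma trace_zero_elliptic:
  assumes A: "gauss_sl2 a b c d" and tr: "a + d = 0"
  shows "elliptic (pm a b c d)"
proof -
  have d: "d = - a"
    using tr by (simp add: eq_neg_iff_add_eq_0 add.commute)
  have "\<exists>x\<in>H3. poincare_ext (mat22 a b c d) x = x"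
  proof (cases "c = 0")
    case True
    have "- (a * a) = 1"
      using A True by (simp add: gauss_sl2_def d)
    then have "a * a = -1"
      by (metis minus_minus)
    then have "(cmod a)\<^sup>2 = 1"
      by (metis norm_minus_cancel norm_mult norm_one power2_eq_square)
    then have aa: "a * cnj a = 1"
      by (metis complex_norm_square of_real_1)
    then have "a \<noteq> 0"
      by auto
    have inv: "cnj a = 1 / a"
      using aa \<open>a \<noteq> 0\<close> by (simp add: field_simps)
    have "cmod a = 1"
      using \<open>(cmod a)\<^sup>2 = 1\<close> power2_eq_1_iff[of "cmod a"] norm_ge_zero[of a] by linarith
    then have "poincare_ext (mat22 a b c d) (- b / (2 * a), 1) = (- b / (2 * a), 1)"
      using \<open>a \<noteq> 0\<close> by (simp add: poincare_ext_def True d inv field_simps)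
    then show ?thesis
      by (intro bexI[of _ "(- b / (2 * a), 1)"]) (auto simp: H3_def)
  next
    case False
    have "c * (a / c) + d = 0"
      using False by (simp add: d)
    moreover have "cnj a + cnj d = 0"
      by (simp add: d)
    ultimately have "poincare_ext (mat22 a b c d) (a / c, 1 / cmod c) = (a / c, 1 / cmod c)"
      using False complex_norm_square[of c]
      by (simp add: poincare_ext_def power_divide)
    then show ?thesis
      using False by (intro bexI[of _ "(a / c, 1 / cmod c)"]) (auto simp: H3_def)
  qed
  then show ?thesis
    unfolding elliptic_def using invariants_H3_iff by blast
qed

text \<open>After a translation, the fixed point is \<open>(0, t)\<close>, and the matrix then has diagonal entries \<open>al\<close> and
  \<open>dl\<close>. The fixed point equations force \<open>al = cnj dl\<close> and \<open>|dl| \<le> 1\<close>, so the trace is a real number in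
  \<open>[-2, 2]\<close> and thus one of five integers. At the two ends \<open>|dl| = 1\<close>, and this makes the matrix
  scalar.\<close>

lemma elliptic_trace:
  assumes A: "gauss_sl2 a b c d" and ell: "elliptic (pm a b c d)"
  shows "a + d \<in> {0, 1, -1} \<or> (c = 0 \<and> a = d)"
proof -
  obtain z t where "(z, t) \<in> H3" and fp: "poincare_ext (mat22 a b c d) (z, t) = (z, t)"
    using ell unfolding elliptic_def by (metis ex_in_conv invariants_H3_iff surj_pair)
  then have t: "t > 0"
    by (simp add: H3_def)
  define dl where "dl = c * z + d"
  define n where "n = (cmod dl)\<^sup>2 + (cmod c)\<^sup>2 * t\<^sup>2"
  have fp1: "((a * z + b) * cnj dl + a * cnj c * of_real (t\<^sup>2)) / of_real n = z" and fp2: "t / n = t"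
    using fp by (simp_all add: poincare_ext_def Let_def dl_def n_def)
  have "n \<noteq> 0"
    using fp2 t by auto
  then have "t * n = t * 1"
    using fp2 by (simp add: field_simps)
  then have n1: "n = 1"
    using t by simp
  have nn: "dl * cnj dl + c * cnj c * of_real (t\<^sup>2) = 1"
    using arg_cong[OF n1, of complex_of_real] unfolding n_def complex_norm_square[symmetric]
    by simp
  have eq: "(a * z + b) * cnj dl + a * cnj c * of_real (t\<^sup>2) = z"
    using fp1 by (simp add: n1)
  define al be where "al = a - c * z" and "be = a * z + b - z * dl"
  have "be * cnj dl + al * cnj c * of_real (t\<^sup>2) =
      ((a * z + b) * cnj dl + a * cnj c * of_real (t\<^sup>2)) - z * (dl * cnj dl + c * cnj c * of_real (t\<^sup>2))"
    by (simp add: al_def be_def algebra_simps)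
  then have be0: "be * cnj dl + al * cnj c * of_real (t\<^sup>2) = 0"
    unfolding eq nn by simp
  have "al * dl - be * c = a * d - b * c"
    by (simp add: al_def be_def dl_def algebra_simps)
  then have det: "al * dl - be * c = 1"
    using A by (simp add: gauss_sl2_def)
  have "al * (dl * cnj dl + c * cnj c * of_real (t\<^sup>2)) =
      (al * dl - be * c) * cnj dl + c * (be * cnj dl + al * cnj c * of_real (t\<^sup>2))"
    by (simp add: algebra_simps)
  then have al: "al = cnj dl"
    unfolding nn det be0 by simp
  have "a + d = al + dl"
    by (simp add: al_def dl_def)
  then have tr: "a + d = of_real (2 * Re dl)"
    by (simp add: al complex_eq_iff)
  have "a + d \<in> gauss_ints"
    using A by (simp add: gauss_sl2_def)
  then have "2 * Re dl \<in> \<int>"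
    unfolding tr by (simp add: gauss_ints_def)
  then obtain k :: int where k: "2 * Re dl = of_int k"
    by (rule Ints_cases)
  have nn': "(cmod dl)\<^sup>2 + (cmod c)\<^sup>2 * t\<^sup>2 = 1"
    using n1 by (simp add: n_def)
  then have "(cmod dl)\<^sup>2 \<le> 1"
    by (smt (verit) mult_nonneg_nonneg zero_le_power2)
  then have "cmod dl \<le> 1"
    by (simp add: power_le_one_iff abs_square_le_1)
  then have Re: "\<bar>Re dl\<bar> \<le> 1"
    using abs_Re_le_cmod[of dl] by linarith
  then have "\<bar>k\<bar> \<le> 2"
    using k by linarith
  then have "k \<in> {-2, -1, 0, 1, 2}"
    by auto
  then show ?thesis
  proof (cases "k \<in> {-1, 0, 1}")
    case True
    then show ?thesis
      unfolding tr k by auto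
  next
    case False
    then have "\<bar>Re dl\<bar> = 1"
      using \<open>k \<in> {-2, -1, 0, 1, 2}\<close> k by auto
    then have "(Re dl)\<^sup>2 = 1"
      by (metis one_power2 power2_abs)
    moreover have "(cmod dl)\<^sup>2 = (Re dl)\<^sup>2 + (Im dl)\<^sup>2"
      by (rule cmod_power2)
    ultimately have "(Im dl)\<^sup>2 + (cmod c)\<^sup>2 * t\<^sup>2 = 0"
      using nn' by linarith
    then have "(Im dl)\<^sup>2 = 0" "(cmod c)\<^sup>2 * t\<^sup>2 = 0"
      by (smt (verit) mult_nonneg_nonneg zero_le_power2)+
    then have "Im dl = 0" "c = 0"
      using t by auto
    moreover from this have "a = cnj d" "dl = d"
      using al by (simp_all add: al_def dl_def)
    ultimately show ?thesis
      by (simp add: complex_eq_iff)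
  qed
qed

text \<open>The fixed points are the roots of \<open>c z\<^sup>2 + (d - a) z - b\<close>, whose discriminant is the square of the
  trace minus 4.\<close>

lemma card_fixed_points:
  assumes A: "gauss_sl2 a b c d" and c: "c \<noteq> 0"
  shows "card (invariants UNIV act_sphere (pm a b c d)) = (if (a + d)\<^sup>2 = 4 then 1 else 2)"
proof -
  define w where "w = csqrt ((a + d)\<^sup>2 - 4)"
  have w2: "w * w = (a + d)\<^sup>2 - 4"
    by (simp add: w_def flip: power2_eq_square)
  define z1 z2 where "z1 = (a - d + w) / (2 * c)" and "z2 = (a - d - w) / (2 * c)"
  have det: "a * d - b * c = 1"
    using A by (simp add: gauss_sl2_def)
  have quad: "4 * c * c * ((z - z1) * (z - z2)) = 4 * c * (z * (c * z + d) - (a * z + b))" for z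
  proof -
    have "2 * c * (z - z1) = 2 * c * z - (a - d + w)" "2 * c * (z - z2) = 2 * c * z - (a - d - w)"
      using c unfolding right_diff_distrib z1_def z2_def by simp_all
    moreover have "4 * c * c * (u * v) = (2 * c * u) * (2 * c * v)" for u v
      by (simp add: algebra_simps)
    ultimately have "4 * c * c * ((z - z1) * (z - z2))
        = (2 * c * z - (a - d + w)) * (2 * c * z - (a - d - w))"
      by (simp only:)
    also have "\<dots> = (2 * c * z - (a - d))\<^sup>2 - w * w"
      by (simp add: power2_eq_square algebra_simps)
    also have "\<dots> = 4 * c * (z * (c * z + d) - (a * z + b)) + 4 * (1 - (a * d - b * c))"
      unfolding w2 by (simp add: power2_eq_square algebra_simps)
    finally show ?thesis
      by (simp add: det)
  qed
  have nonzero: "4 * c * u = 0 \<longleftrightarrow> u = 0" "4 * c * c * u = 0 \<longleftrightarrow> u = 0" for u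
    using c by simp_all
  have "moebius (mat22 a b c d) (Some z) = Some z \<longleftrightarrow> z = z1 \<or> z = z2" for z
  proof -
    have "moebius (mat22 a b c d) (Some z) = Some z \<longleftrightarrow> z * (c * z + d) - (a * z + b) = 0"
    proof (cases "c * z + d = 0")
      case True
      have "a * z + b \<noteq> 0"
      proof
        assume "a * z + b = 0"
        then have "b = - (a * z)"
          unfolding add_eq_0_iff .
        moreover have "d = - (c * z)"
          using True unfolding add_eq_0_iff .
        ultimately show False
          using det by simp
      qed
      then have "0 - (a * z + b) \<noteq> 0"
        unfolding right_minus_eq by metis
      then show ?thesis
        unfolding True mult_zero_right by (simp add: moebius_def True)
    next
      case False
      then have "moebius (mat22 a b c d) (Some z) = Some ((a * z + b) / (c * z + d))"
        by (simp add: moebius_def)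
      moreover have "(a * z + b) / (c * z + d) = z \<longleftrightarrow> a * z + b = z * (c * z + d)"
        by (simp only: divide_eq_eq False if_False not_False_eq_True if_True)
      ultimately show ?thesis
        unfolding right_minus_eq by (metis option.inject)
    qed
    also have "\<dots> \<longleftrightarrow> (z - z1) * (z - z2) = 0"
      using quad[of z] nonzero(1)[of "z * (c * z + d) - (a * z + b)"] nonzero(2)[of "(z - z1) * (z - z2)"]
      by (simp only:)
    finally show ?thesis
      by simp
  qed
  moreover have "moebius (mat22 a b c d) None \<noteq> None"
    using c by (simp add: moebius_def)
  ultimately have "p \<in> invariants UNIV act_sphere (pm a b c d) \<longleftrightarrow> p \<in> {Some z1, Some z2}" for p
    unfolding invariants_sphere_iff by (cases p) auto
  then have "invariants UNIV act_sphere (pm a b c d) = {Some z1, Some z2}"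
    by blast
  moreover have "2 * c * (z1 - z2) = 2 * w"
    unfolding right_diff_distrib z1_def z2_def using c by simp
  then have "z1 = z2 \<longleftrightarrow> w = 0"
    using c by auto
  moreover have "w = 0 \<longleftrightarrow> (a + d)\<^sup>2 = 4"
    unfolding w_def csqrt_eq_0 right_minus_eq ..
  moreover have "card {Some z1, Some z2} = (if z1 = z2 then 1 else 2)"
    by simp
  ultimately show ?thesis
    by (simp only:)
qed

lemma translation_parabolic:
  assumes "gauss_sl2 a b 0 a" "b \<noteq> 0"
  shows "parabolic (pm a b 0 a)"
proof -
  have "a \<noteq> 0"
    using assms by (auto simp: gauss_sl2_def)
  then have "(a * z + b) / a = z + b / a" "b / a \<noteq> 0" for z
    using assms(2) by (simp_all add: add_divide_distrib)
  then have "moebius (mat22 a b 0 a) (Some z) \<noteq> Some z" for z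
    using \<open>a \<noteq> 0\<close> by (simp add: moebius_def)
  moreover have "moebius (mat22 a b 0 a) None = None"
    by (simp add: moebius_def)
  ultimately have "moebius (mat22 a b 0 a) p = p \<longleftrightarrow> p = None" for p
    by (cases p) simp_all
  then have fixed: "p \<in> invariants UNIV act_sphere (pm a b 0 a) \<longleftrightarrow> p \<in> {None}" for p
    unfolding invariants_sphere_iff singleton_iff .
  have "invariants UNIV act_sphere (pm a b 0 a) = {None}"
    by (rule Set.set_eqI, rule fixed)
  then show ?thesis
    by (simp add: parabolic_def)
qed

lemma scalar_elliptic:
  assumes "gauss_sl2 a 0 0 a"
  shows "elliptic (pm a 0 0 a)"
proof -
  have "a * a = 1"
    using assms by (simp add: gauss_sl2_def)
  then have "a = 1 \<or> a = -1"
    by (simp add: square_eq_1_iff)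
  then have "pm a 0 0 a = pm 1 0 0 1"
    by (auto simp: pm_eq_iff)
  then show ?thesis
    using one_elliptic by simp
qed

text \<open>If \<open>c = 0\<close>, the trace is 0 or the element is a translation (or the identity).\<close>

lemma loxodromic_lift:
  assumes A: "gauss_sl2 a b c d" and "\<not> elliptic (pm a b c d)" "\<not> parabolic (pm a b c d)"
  shows "c \<noteq> 0" "(a + d)\<^sup>2 \<noteq> 0" "(a + d)\<^sup>2 \<noteq> 4"
proof -
  have tr: "a + d \<noteq> 0"
    using assms trace_zero_elliptic by blast
  then show "(a + d)\<^sup>2 \<noteq> 0"
    by simp
  show c: "c \<noteq> 0"
  proof
    assume c: "c = 0"
    then have "a = d"
      using gauss_sl2_lower_zero[of a b d] A tr by blast
    then have A': "gauss_sl2 a b 0 a" and eq: "pm a b c d = pm a b 0 a"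
      using A c by simp_all
    show False
    proof (cases "b = 0")
      case True
      then show False
        using scalar_elliptic[of a] A' assms(2) unfolding eq by simp
    next
      case False
      then show False
        using translation_parabolic[OF A'] assms(3) unfolding eq by blast
    qed
  qed
  show "(a + d)\<^sup>2 \<noteq> 4"
  proof
    assume "(a + d)\<^sup>2 = 4"
    then have "card (invariants UNIV act_sphere (pm a b c d)) = 1"
      unfolding card_fixed_points[OF A c] by (rule if_P)
    then show False
      using assms(3) unfolding parabolic_def by blast
  qed
qed

lemma elliptic_parabolic_or_loxodromic:
  assumes "g \<in> carrier Picard" "\<not> elliptic g" "\<not> parabolic g"
  shows "loxodromic g"
proof -
  obtain a b c d where A: "gauss_sl2 a b c d" and g: "g = pm a b c d"
    using assms(1) by (rule Picard_elem_cases)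
  have c: "c \<noteq> 0" and tr: "(a + d)\<^sup>2 \<noteq> 4"
    using loxodromic_lift[OF A] assms(2,3) unfolding g by blast+
  have "card (invariants UNIV act_sphere g) = 2"
    unfolding g card_fixed_points[OF A c] using tr by (rule if_not_P)
  then show ?thesis
    using assms(2) unfolding loxodromic_def by blast
qed

lemma loxodromic_not_parabolic: "loxodromic g \<Longrightarrow> \<not> parabolic g"
  by (simp add: loxodromic_def parabolic_def)

section \<open>Reversibility\<close>

lemma reversible_trace_zero:
  assumes "gauss_sl2 a b c d" "a + d = 0"
  shows "reversible Picard (pm a b c d)"
proof -
  have "d = - a"
    using assms(2) unfolding add_eq_0_iff .
  then have "gauss_sl2 a b c (- a)" "pm a b c d = pm a b c (- a)"
    using assms(1) by simp_all
  then show ?thesis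
    using Picard.involution_reversible[OF pm_in_Picard pm_involution] by simp
qed

lemma reversible_if_divides:
  assumes "gauss_sl2 a b c d" "f \<in> gauss_ints" "a - d = f * c"
  shows "reversible Picard (pm a b c d)"
  using eta_reverser[OF assms] unfolding reversible_iff_reverser by blast

lemma reversible_lower_zero:
  assumes "gauss_sl2 a b 0 d"
  shows "reversible Picard (pm a b 0 d)"
proof (cases "a + d = 0")
  case True
  with assms show ?thesis
    by (rule reversible_trace_zero)
next
  case False
  then have "a = d"
    using gauss_sl2_lower_zero[OF assms] by blast
  then show ?thesis
    by (intro reversible_if_divides[OF assms, of 0]) simp_all
qed

text \<open>Elements of order three are reversible because each of them has a conjugate whose entry \<open>c\<close> is a
  unit, so that \<open>c\<close> divides \<open>a - d\<close>. To reach it, a translation makes \<open>d - a\<close> small modulo \<open>2 c\<close>;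
  since \<open>4 b c = - 3 - (d - a)\<^sup>2\<close> for trace 1, the entry \<open>b\<close> is then smaller than \<open>c\<close> unless \<open>c\<close> is a
  unit, and conjugation by \<open>z \<mapsto> - 1 / z\<close> interchanges the two.\<close>

lemma reversible_trace_one:
  assumes "gauss_sl2 a b c d" "a + d = 1"
  shows "reversible Picard (pm a b c d)"
proof -
  have "c \<in> gauss_ints"
    using assms by (simp add: gauss_sl2_def)
  then obtain N :: nat where "(cmod c)\<^sup>2 = of_nat N"
    by (rule gauss_norm_nat)
  with assms show ?thesis
  proof (induction N arbitrary: a b c d rule: less_induct)
    case (less N)
    note A = less.prems(1)
    have G: "a \<in> gauss_ints" "b \<in> gauss_ints" "c \<in> gauss_ints" "d \<in> gauss_ints"
      using A by (auto simp: gauss_sl2_def)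
    consider "N = 0" | "N = 1" | "N \<ge> 2"
      by linarith
    then show ?case
    proof cases
      case 1
      then show ?thesis
        using A less.prems(3) reversible_lower_zero by simp
    next
      case 2
      then have "c * cnj c = 1"
        using less.prems(3) by (metis complex_norm_square of_nat_1 of_real_1)
      then have "a - d = ((a - d) * cnj c) * c"
        by (simp add: mult.assoc mult.commute[of "cnj c" c])
      then show ?thesis
        using G by (intro reversible_if_divides[OF A, of "(a - d) * cnj c"]) simp_all
    next
      case 3
      then have c: "c \<noteq> 0"
        using less.prems(3) by auto
      obtain q where q: "q \<in> gauss_ints" "(cmod ((d - a) / (2 * c) - q))\<^sup>2 \<le> 1 / 2"
        by (rule gauss_round)
      define a' b' d' where "a' = a + q * c" and "b' = (b + q * d) - (a + q * c) * q" and "d' = d - c * q"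
      have T: "gauss_sl2 1 q 0 1" and W: "gauss_sl2 0 1 (-1) 0"
        using q by (simp_all add: gauss_sl2_def)
      have A': "gauss_sl2 a' b' c d'"
        using gauss_sl2_conjugate[OF T A] by (simp add: a'_def b'_def d'_def)
      have A'': "gauss_sl2 d' (- c) (- b') a'"
        using gauss_sl2_conjugate[OF W A'] by simp
      have conj: "conjugate Picard (pm 1 q 0 1) (pm a b c d) = pm a' b' c d'"
        unfolding conjugate_pm[OF T] by (simp add: a'_def b'_def d'_def)
      have conj': "conjugate Picard (pm 0 1 (-1) 0) (pm a' b' c d') = pm d' (- c) (- b') a'"
        unfolding conjugate_pm[OF W] by simp
      have tr: "a' + d' = 1"
        using less.prems(2) by (simp add: a'_def d'_def algebra_simps)
      have eq: "4 * (b' * c) = (a' + d')\<^sup>2 - 4 * (a' * d' - b' * c) - (d' - a')\<^sup>2"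
        by (simp add: power2_eq_square algebra_simps)
      have det': "a' * d' - b' * c = 1"
        using A' by (simp add: gauss_sl2_def)
      have bc: "4 * (b' * c) = - (3 + (d' - a')\<^sup>2)"
        by (simp only: eq tr det') simp
      have c_cancel: "2 * c * ((d - a) / (2 * c)) = d - a"
        using c by simp
      have "d' - a' = 2 * c * ((d - a) / (2 * c) - q)"
        unfolding right_diff_distrib c_cancel by (simp add: a'_def d'_def algebra_simps)
      then have "(cmod (d' - a'))\<^sup>2 = 4 * (cmod c)\<^sup>2 * (cmod ((d - a) / (2 * c) - q))\<^sup>2"
        by (simp add: norm_mult power_mult_distrib)
      also have "\<dots> \<le> 4 * (cmod c)\<^sup>2 * (1 / 2)"
        using q by (intro mult_left_mono) auto
      finally have le: "(cmod (d' - a'))\<^sup>2 \<le> 2 * (cmod c)\<^sup>2"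
        by simp
      have "4 * (cmod b' * cmod c) = cmod (4 * (b' * c))"
        by (simp add: norm_mult)
      also have "\<dots> \<le> 3 + (cmod (d' - a'))\<^sup>2"
        unfolding bc norm_minus_cancel using norm_triangle_ineq[of 3 "(d' - a')\<^sup>2"]
        by (simp add: norm_power)
      also have "\<dots> < 4 * (cmod c)\<^sup>2"
        using le 3 less.prems(3) by simp
      finally have "cmod b' * cmod c < cmod c * cmod c"
        by (simp add: power2_eq_square)
      then have lt: "cmod b' < cmod c"
        using c by simp
      obtain M :: nat where M: "(cmod (- b'))\<^sup>2 = of_nat M"
        using A'' by (auto simp: gauss_sl2_def elim: gauss_norm_nat)
      have "(cmod (- b'))\<^sup>2 < (cmod c)\<^sup>2"
        using lt by (simp add: power_strict_mono)
      then have "M < N"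
        unfolding M less.prems(3) by simp
      then have "reversible Picard (pm d' (- c) (- b') a')"
        using less.IH[OF _ A'' _ M] tr by (simp add: add.commute)
      then have "reversible Picard (pm a' b' c d')"
        using Picard.reversible_conjugate_iff[of "pm 0 1 (-1) 0" "pm a' b' c d'"] W A' conj' by simp
      then show ?thesis
        using Picard.reversible_conjugate_iff[of "pm 1 q 0 1" "pm a b c d"] T A conj by simp
    qed
  qed
qed

lemma elliptic_reversible:
  assumes "g \<in> carrier Picard" "elliptic g"
  shows "reversible Picard g"
proof -
  obtain a b c d where A: "gauss_sl2 a b c d" and g: "g = pm a b c d"
    using assms(1) by (rule Picard_elem_cases)
  consider "a + d = 0" | "a + d = 1" | "a + d = -1" | "c = 0"
    using elliptic_trace[OF A] assms(2) g by blast
  then show ?thesis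
  proof cases
    case 1
    then show ?thesis
      unfolding g by (rule reversible_trace_zero[OF A])
  next
    case 2
    then show ?thesis
      unfolding g by (rule reversible_trace_one[OF A])
  next
    case 3
    have "- a + - d = - (a + d)"
      by simp
    then have "- a + - d = 1"
      unfolding 3 by simp
    moreover have "gauss_sl2 (- a) (- b) (- c) (- d)"
      using A by (simp add: gauss_sl2_def)
    ultimately have "reversible Picard (pm (- a) (- b) (- c) (- d))"
      using reversible_trace_one by blast
    moreover have "pm a b c d = pm (- a) (- b) (- c) (- d)"
      by (simp add: pm_eq_iff)
    ultimately show ?thesis
      unfolding g by simp
  next
    case 4
    show ?thesis
      using A unfolding g 4 by (rule reversible_lower_zero)
  qed
qed

lemma parabolic_reversible:
  assumes "g \<in> carrier Picard" "parabolic g"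
  shows "reversible Picard g"
proof -
  obtain a b c d where A: "gauss_sl2 a b c d" and g: "g = pm a b c d"
    using assms(1) by (rule Picard_elem_cases)
  show ?thesis
  proof (cases "c = 0")
    case True
    then show ?thesis
      using A g reversible_lower_zero by simp
  next
    case False
    have "card (invariants UNIV act_sphere (pm a b c d)) = 1"
      using assms(2) unfolding g parabolic_def .
    then have "(a + d)\<^sup>2 = 2\<^sup>2"
      unfolding card_fixed_points[OF A False] by (simp split: if_splits)
    then have "a + d = 2 * 1 \<or> a + d = 2 * (- 1)"
      unfolding power2_eq_iff by simp
    then obtain lam where lam: "lam = 1 \<or> lam = -1" "a + d = 2 * lam"
      by blast
    then have "lam \<in> gauss_ints" "lam\<^sup>2 - (a + d) * lam + 1 = 0"
      unfolding lam(2) by auto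
    then obtain x b' where x: "x \<in> carrier Picard"
      and xA: "conjugate Picard x (pm a b c d) = pm lam b' 0 (a + d - lam)"
      and "gauss_sl2 lam b' 0 (a + d - lam)"
      using conjugate_upper_triangular[OF A] by blast
    then have "reversible Picard (conjugate Picard x g)"
      unfolding g using reversible_lower_zero by simp
    then show ?thesis
      using Picard.reversible_conjugate_iff x assms(1) by blast
  qed
qed

text \<open>When \<open>c = 0\<close> the quotient defining \<open>f_of\<close> has the default value 0; upper triangular elements are
  reversible in any case.\<close>

lemma f_of_parity_reversible:
  assumes "h \<in> carrier Picard" "f_of h \<in> gauss_parities"
  shows "reversible Picard h"
proof -
  obtain a b c d where A: "gauss_sl2 a b c d" and h: "h = pm a b c d"
    using assms(1) by (rule Picard_elem_cases)
  show ?thesis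
  proof (cases "c = 0")
    case True
    then show ?thesis
      using A h reversible_lower_zero by simp
  next
    case False
    then have "a - d = f_of h * c"
      by (simp add: h f_of_pm)
    then show ?thesis
      unfolding h[symmetric] using A h assms(2) reversible_if_divides by (metis gauss_parities_gauss)
  qed
qed

lemma loxodromic_reverser_conjugate_eta:
  assumes "g \<in> carrier Picard" "loxodromic g" and rev: "reverser Picard g k"
  shows "k \<otimes>\<^bsub>Picard\<^esub> k = \<one>\<^bsub>Picard\<^esub>"
    and "\<exists>x\<in>carrier Picard. conjugate Picard x k \<in> eta ` gauss_parities"
proof -
  obtain a b c d where A: "gauss_sl2 a b c d" and g: "g = pm a b c d"
    using assms(1) by (rule Picard_elem_cases)
  have c: "c \<noteq> 0" and tr: "a + d \<noteq> 0"
    using loxodromic_lift[OF A] assms(2) loxodromic_not_parabolic unfolding g loxodromic_def by auto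
  have "k \<in> carrier Picard"
    using rev by (simp add: reverser_def)
  then obtain p q r s where H: "gauss_sl2 p q r s" and k: "k = pm p q r s"
    by (rule Picard_elem_cases)
  have s: "s = - p"
    using reverser_trace_zero(1)[OF A H _ tr c] rev by (simp add: g k)
  show "k \<otimes>\<^bsub>Picard\<^esub> k = \<one>\<^bsub>Picard\<^esub>"
    unfolding k s using H pm_involution by (simp add: s)
  show "\<exists>x\<in>carrier Picard. conjugate Picard x k \<in> eta ` gauss_parities"
    unfolding k s using involution_conjugate_eta[of p q r] H by (metis s image_eqI)
qed

text \<open>Having \<open>f\<close> as value of \<open>f_of\<close> means being reversed by the half-turn \<open>eta f\<close>. This is stated for
  all conjugates of \<open>g\<close>: the square of the trace, which differs from 0 and 4, keeps their lower left
  entry away from 0.\<close>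

lemma loxodromic_eta_reverser_iff:
  assumes g: "g \<in> carrier Picard" "loxodromic g" and h: "h \<in> conjugacy_class Picard g"
    and f: "f \<in> gauss_parities"
  shows "reverser Picard h (eta f) \<longleftrightarrow> f_of h = f"
proof -
  obtain a b c d where A: "gauss_sl2 a b c d" and gA: "g = pm a b c d"
    using g(1) by (rule Picard_elem_cases)
  have tr: "(a + d)\<^sup>2 \<noteq> 0" "(a + d)\<^sup>2 \<noteq> 4"
    using loxodromic_lift[OF A] g(2) loxodromic_not_parabolic unfolding gA loxodromic_def by auto
  obtain x where x: "x \<in> carrier Picard" and hx: "h = conjugate Picard x g"
    using h by (auto simp: conjugacy_class_eq_conjugate)
  have "h \<in> carrier Picard"
    using x g hx by simp
  then obtain a' b' c' d' where B: "gauss_sl2 a' b' c' d'" and hB: "h = pm a' b' c' d'"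
    by (rule Picard_elem_cases)
  have tr': "(a' + d')\<^sup>2 = (a + d)\<^sup>2"
    using trace_square_conjugate[OF x] hx hB gA by metis
  then have "a' + d' \<noteq> 0"
    using tr(1) by auto
  moreover have "c' \<noteq> 0"
  proof
    assume "c' = 0"
    then have "a' = d' \<and> (a' = 1 \<or> a' = -1)"
      using gauss_sl2_lower_zero[of a' b' d'] B \<open>a' + d' \<noteq> 0\<close> by blast
    then show False
      using tr' tr(2) by auto
  qed
  ultimately show ?thesis
    unfolding hB using eta_reverser_iff_f_of[OF B] f by simp
qed

lemma reversible_iff_conjugate_parity:
  assumes g: "g \<in> carrier Picard"
  shows "reversible Picard g \<longleftrightarrow> elliptic g \<or> parabolic g \<or>
    (loxodromic g \<and> (\<exists>h \<in> conjugacy_class Picard g. f_of h \<in> gauss_parities))"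
proof
  assume rev: "reversible Picard g"
  have "\<exists>h \<in> conjugacy_class Picard g. f_of h \<in> gauss_parities" if lox: "loxodromic g"
  proof -
    obtain k where k: "reverser Picard g k"
      using rev unfolding reversible_iff_reverser by blast
    then obtain x f where x: "x \<in> carrier Picard" and f: "f \<in> gauss_parities"
      and xk: "conjugate Picard x k = eta f"
      using loxodromic_reverser_conjugate_eta(2)[OF g lox k] by blast
    have h: "conjugate Picard x g \<in> conjugacy_class Picard g"
      using x by (auto simp: conjugacy_class_eq_conjugate)
    have "reverser Picard (conjugate Picard x g) (eta f)"
      using Picard.reverser_conjugate[OF k x g] xk by simp
    then have "f_of (conjugate Picard x g) = f"
      using loxodromic_eta_reverser_iff[OF g lox h f] by blast
    then show ?thesis
      using h f by blast
  qed
  then show "elliptic g \<or> parabolic g \<or>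
    (loxodromic g \<and> (\<exists>h \<in> conjugacy_class Picard g. f_of h \<in> gauss_parities))"
    using elliptic_parabolic_or_loxodromic g by blast
next
  assume "elliptic g \<or> parabolic g \<or>
    (loxodromic g \<and> (\<exists>h \<in> conjugacy_class Picard g. f_of h \<in> gauss_parities))"
  moreover have "reversible Picard g" if "x \<in> carrier Picard" "f_of (conjugate Picard x g) \<in> gauss_parities" for x
    using f_of_parity_reversible[OF Picard.conjugate_closed[OF that(1) g] that(2)]
    unfolding Picard.reversible_conjugate_iff[OF that(1) g] .
  ultimately show "reversible Picard g"
    using g elliptic_reversible parabolic_reversible by (auto simp: conjugacy_class_eq_conjugate)
qed

section \<open>Counting conjugates\<close>

lemma card_parity_elements:
  assumes g: "g \<in> carrier Picard" and rev: "reversible Picard g" and lox: "loxodromic g"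
    and cyc: "infinite_cyclic Picard (centralizer Picard g)"
  shows "card {h \<in> conjugacy_class Picard g. f_of h \<in> gauss_parities} = 8"
proof -
  have "card {h \<in> conjugacy_class Picard g. \<exists>f\<in>gauss_parities. reverser Picard h (eta f)} = 2 * 4"
  proof (rule Picard.card_conjugates_with_reverser[OF g cyc rev])
    show "f = f'" if "x \<in> carrier Picard" "f \<in> gauss_parities" "f' \<in> gauss_parities"
      "conjugate Picard x (eta f) = eta f'" for x f f'
    proof -
      obtain p q r where T: "gauss_sl2 p q r (- p)" "r \<noteq> 0" "2 * p = f' * r"
        using \<open>f' \<in> gauss_parities\<close> by (rule eta_swap_ex)
      have "f' = f"
        using conjugate_eta_eq_eta[OF that(1,3,2,4) refl T(1,3)] by (rule conjunct1)
      then show ?thesis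
        by simp
    qed
    show "f = f'" if "h \<in> conjugacy_class Picard g" "f \<in> gauss_parities" "f' \<in> gauss_parities"
      "reverser Picard h (eta f)" "reverser Picard h (eta f')" for h f f'
      using loxodromic_eta_reverser_iff[OF g lox that(1)] that by simp
    show "k \<otimes>\<^bsub>Picard\<^esub> k = \<one>\<^bsub>Picard\<^esub>"
      "\<exists>x\<in>carrier Picard. conjugate Picard x k \<in> eta ` gauss_parities" if "reverser Picard g k" for k
      using loxodromic_reverser_conjugate_eta[OF g lox that] by blast+
  qed (simp_all add: card_centralizer_eta)
  moreover have "{h \<in> conjugacy_class Picard g. \<exists>f\<in>gauss_parities. reverser Picard h (eta f)}
      = {h \<in> conjugacy_class Picard g. f_of h \<in> gauss_parities}"
    using loxodromic_eta_reverser_iff[OF g lox] by blast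
  ultimately show ?thesis
    by simp
qed

theorem theorem1p1:
  shows "(\<forall>g \<in> carrier Picard. reversible Picard g \<longleftrightarrow>
            elliptic g \<or>
            parabolic g \<or>
            (loxodromic g \<and> (\<exists>h \<in> conjugacy_class Picard g. f_of h \<in> {0, 1, \<i>, 1 + \<i>})))
       \<and> (\<forall>C \<in> conjugacy_class Picard ` carrier Picard.
            (\<forall>g \<in> C. reversible Picard g \<and> loxodromic g
                    \<and> infinite_cyclic Picard (centralizer Picard g))
            \<longrightarrow> card {h \<in> C. f_of h \<in> {0, 1, \<i>, 1 + \<i>}} = 8)"
proof -
  have "g \<in> conjugacy_class Picard g" if "g \<in> carrier Picard" for g
    unfolding conjugacy_class_eq_conjugate using Picard.conjugate_one[OF that, symmetric] by blast
  then show ?thesis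
    using reversible_iff_conjugate_parity card_parity_elements unfolding gauss_parities_def by blast
qed

end
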